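(* Let $q$ be a prime power, let $n\geq 2$ and $m\geq 1$ be integers, and suppose that $\mathcal{O}$ is an $m$-ovoid of the elliptic quadric $Q^-(2n+1,q)$. Then any elliptic quadric $Q^-(2n-1,q)\subset Q^-(2n+1,q)$ meets $\mathcal{O}$ in exactly $(m-2)q^{n-1}+m$, $(m-1)q^{n-1}+m$ or $mq^{n-1}+m$ points, and all of these cases occur.
   Context: $Q^-(2n+1,q)$ is the set of points of $\mathrm{PG}(2n+1,q)$ that are zeros of a non-singular quadratic form on $\mathbb{F}_q^{2n+2}$ of Witt index $n$ (elliptic form). Its generators are the maximal totally singular subspaces, of projective dimension $n-1$. An $m$-ovoid of $Q^-(2n+1,q)$ is a set of points of the quadric meeting every generator in exactly $m$ points. An elliptic quadric $Q^-(2n-1,q)\subset Q^-(2n+1,q)$ means the intersection of $Q^-(2n+1,q)$ with a $(2n-1)$-dimensional projective subspace of $\mathrm{PG}(2n+1,q)$ on which the restricted quadratic form is non-singular of Witt index $n-1$.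
   Formalization: Occurrence of the second and third values is asserted only for O different from the whole quadric; for O the whole quadric, an m-ovoid with m=(q^n-1)/(q-1), only the value (m-2)q^{n-1}+m occurs. *)

theory Defs
  imports "HOL-Analysis.Analysis"
begin

definition polar_form :: "('a::field ^ 'k \<Rightarrow> 'a) \<Rightarrow> 'a ^ 'k \<Rightarrow> 'a ^ 'k \<Rightarrow> 'a" where
  "polar_form Q x y = Q (x + y) - Q x - Q y"

(* Valid in every characteristic. The polar form is symmetric by construction, so linearity in
   its first argument is bilinearity. *)
definition quadratic_form :: "('a::field ^ 'k \<Rightarrow> 'a) \<Rightarrow> bool" where
  "quadratic_form Q \<longleftrightarrow>
     (\<forall>c x. Q (c *s x) = c\<^sup>2 * Q x) \<and>
     (\<forall>x x' y. polar_form Q (x + x') y = polar_form Q x y + polar_form Q x' y) \<and>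
     (\<forall>c x y. polar_form Q (c *s x) y = c * polar_form Q x y)"

definition nonsingular_on :: "('a::field ^ 'k) set \<Rightarrow> ('a ^ 'k \<Rightarrow> 'a) \<Rightarrow> bool" where
  "nonsingular_on W Q \<longleftrightarrow>
     (\<forall>x\<in>W. (\<forall>y\<in>W. polar_form Q x y = 0) \<longrightarrow> Q x = 0 \<longrightarrow> x = 0)"

definition totally_singular :: "('a::field ^ 'k \<Rightarrow> 'a) \<Rightarrow> ('a ^ 'k) set \<Rightarrow> bool" where
  "totally_singular Q U \<longleftrightarrow> vec.subspace U \<and> (\<forall>x\<in>U. Q x = 0)"

definition witt_index_on :: "('a::field ^ 'k) set \<Rightarrow> ('a ^ 'k \<Rightarrow> 'a) \<Rightarrow> nat" where
  "witt_index_on W Q = Max (vec.dim ` {U. totally_singular Q U \<and> U \<subseteq> W})"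

(* W has vector-space dimension 2r + 2, i.e. projective dimension 2r + 1, so that the singular
   points of W form a quadric of type Q^-(2r+1,q). *)
definition elliptic_on :: "nat \<Rightarrow> ('a::field ^ 'k) set \<Rightarrow> ('a ^ 'k \<Rightarrow> 'a) \<Rightarrow> bool" where
  "elliptic_on r W Q \<longleftrightarrow>
     vec.subspace W \<and> vec.dim W = 2 * r + 2 \<and> nonsingular_on W Q \<and> witt_index_on W Q = r"

(* Projective points are represented by the one-dimensional linear subspaces. *)
definition points_of :: "('a::field ^ 'k) set \<Rightarrow> ('a ^ 'k) set set" where
  "points_of W = {P. vec.subspace P \<and> vec.dim P = 1 \<and> P \<subseteq> W}"

definition quadric :: "('a::field ^ 'k \<Rightarrow> 'a) \<Rightarrow> ('a ^ 'k) set set" where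
  "quadric Q = {P \<in> points_of UNIV. \<forall>x\<in>P. Q x = 0}"

definition generator :: "('a::field ^ 'k \<Rightarrow> 'a) \<Rightarrow> ('a ^ 'k) set \<Rightarrow> bool" where
  "generator Q G \<longleftrightarrow>
     totally_singular Q G \<and> (\<forall>U. totally_singular Q U \<longrightarrow> G \<subseteq> U \<longrightarrow> U = G)"

definition m_ovoid :: "nat \<Rightarrow> ('a::field ^ 'k \<Rightarrow> 'a) \<Rightarrow> ('a ^ 'k) set set \<Rightarrow> bool" where
  "m_ovoid m Q S \<longleftrightarrow>
     S \<subseteq> quadric Q \<and> (\<forall>G. generator Q G \<longrightarrow> card (S \<inter> points_of G) = m)"

definition elliptic_subquadrics :: "nat \<Rightarrow> ('a::field ^ 'k \<Rightarrow> 'a) \<Rightarrow> ('a ^ 'k) set set set" where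
  "elliptic_subquadrics r Q = {quadric Q \<inter> points_of W | W. elliptic_on r W Q}"

end

theory Submission
  imports Defs
begin

text \<open>
  An elliptic quadric of projective dimension \<open>2 * n - 1\<close> is the section by \<open>W = {x, y}\<^sup>\<bottom>\<close> for a pair of
  non-orthogonal singular points \<open>x\<close>, \<open>y\<close>. The \<open>q + 1\<close> hyperplanes through \<open>W\<close> are \<open>z\<^sup>\<bottom>\<close> for the points \<open>z\<close>
  of the line \<open>x y\<close>, and every point outside \<open>W\<close> lies in exactly one of them. The hyperplane \<open>z\<^sup>\<bottom>\<close> meets
  the ovoid in \<open>m (q ^ n + 1)\<close> points if \<open>z\<close> is nonsingular, since the section still contains generators;
  for \<open>z = x\<close> or \<open>z = y\<close> it does so in \<open>q ^ n\<close> points fewer if \<open>z\<close> belongs to the ovoid. As the ovoid has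
  \<open>m (q ^ (n + 1) + 1)\<close> points, the pencil of hyperplanes yields
  \<open>m (q ^ (n - 1) + 1) - s q ^ (n - 1)\<close> points in \<open>W\<close>, where \<open>s\<close> is the number of ovoid points among \<open>x\<close>
  and \<open>y\<close>. A singular point is not orthogonal to all points of an ovoid; applied to the ovoid
  and to its complement this gives all three values of \<open>s\<close>.
\<close>

section \<open>Counting vectors over a finite field\<close>

text \<open>Each basis vector \<open>b\<close> contributes one free coefficient, because
  \<open>c *s b + v\<close> with \<open>v\<close> in the old span represents a vector uniquely.
  Cardinalities can then stand in for dimensions in all later arguments.\<close>

lemma card_subspace:
  fixes U :: "('a::{field,finite} ^ 'k) set"
  assumes "vec.subspace U"
  shows "card U = CARD('a) ^ vec.dim U"
proof -
  have *: "card (vec.span S) = CARD('a) ^ card S" if "vec.independent S" for S :: "('a ^ 'k) set"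
    using finite[of S] that
  proof (induction S rule: finite_induct)
    case empty
    then show ?case by simp
  next
    case (insert b S)
    then have b: "b \<notin> vec.span S" and S: "vec.independent S"
      using vec.independent_insert[of b S] by auto
    have "bij_betw (\<lambda>(c, v). c *s b + v) (UNIV \<times> vec.span S) (vec.span (insert b S))"
    proof (rule bij_betw_imageI)
      show "inj_on (\<lambda>(c, v). c *s b + v) (UNIV \<times> vec.span S)"
      proof (rule inj_onI, clarsimp)
        fix c v d w
        assume v: "v \<in> vec.span S" and w: "w \<in> vec.span S" and e: "c *s b + v = d *s b + w"
        have "(c - d) *s b = (c *s b + v) - v - d *s b"
          by (simp add: vec.scale_left_diff_distrib)
        then have d: "(c - d) *s b = w - v"
          unfolding e by simp
        have "c = d"
        proof (rule ccontr)
          assume "c \<noteq> d"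
          then have "b = inverse (c - d) *s ((c - d) *s b)"
            by (simp only: vec.scale_scale) simp
          also have "\<dots> \<in> vec.span S"
            using v w unfolding d by (intro vec.span_scale vec.span_diff)
          finally show False using b by simp
        qed
        with e show "c = d \<and> v = w" by simp
      qed
      show "(\<lambda>(c, v). c *s b + v) ` (UNIV \<times> vec.span S) = vec.span (insert b S)"
      proof safe
        fix c v assume "v \<in> vec.span S"
        then have "v \<in> vec.span (insert b S)"
          using vec.span_mono[of S "insert b S"] by auto
        then show "c *s b + v \<in> vec.span (insert b S)"
          by (simp add: vec.span_add vec.span_scale vec.span_base)
      next
        fix x assume "x \<in> vec.span (insert b S)"
        then obtain k where k: "x - k *s b \<in> vec.span S"
          using vec.span_breakdown_eq[of x b S] by auto
        show "x \<in> (\<lambda>(c, v). c *s b + v) ` (UNIV \<times> vec.span S)"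
          by (rule image_eqI[of _ _ "(k, x - k *s b)"]) (use k in auto)
      qed
    qed
    from bij_betw_same_card[OF this] show ?case
      using insert S by (simp add: card_cartesian_product)
  qed
  obtain S where "S \<subseteq> U" "vec.independent S" "U \<subseteq> vec.span S" "card S = vec.dim U"
    using vec.basis_exists by blast
  moreover have "vec.span S = U"
    using calculation assms by (simp add: vec.span_subspace)
  ultimately show ?thesis using *[of S] by simp
qed

lemma two_le_CARD_field: "2 \<le> CARD('a::{field,finite})"
proof -
  have "card {0, 1 :: 'a} \<le> CARD('a)" by (rule card_mono) auto
  then show ?thesis by simp
qed

lemma dim_eq_of_card:
  fixes U :: "('a::{field,finite} ^ 'k) set"
  assumes "vec.subspace U" "card U = CARD('a) ^ d"
  shows "vec.dim U = d"
  using card_subspace[OF assms(1)] assms(2) two_le_CARD_field[where 'a='a]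
  by simp

text \<open>Adding a suitable multiple of \<open>w\<close> carries any fibre of \<open>f\<close> on
  \<open>W\<close> onto any other, so all fibres have the same size.\<close>

lemma card_fibre:
  fixes W :: "('a::{field,finite} ^ 'k) set" and f :: "'a ^ 'k \<Rightarrow> 'a"
  assumes W: "vec.subspace W"
    and add: "\<And>x y. f (x + y) = f x + f y" and scale: "\<And>c x. f (c *s x) = c * f x"
    and w: "w \<in> W" "f w \<noteq> 0"
  shows "CARD('a) * card {v \<in> W. f v = c} = card W"
proof -
  have eq: "card {v \<in> W. f v = d} = card {v \<in> W. f v = c}" for d
  proof (rule bij_betw_same_card)
    define u where "u = ((c - d) / f w) *s w"
    have "u \<in> W" "f u = c - d"
      using w W by (auto simp: u_def scale vec.subspace_scale)
    moreover have "f (v - u) = f v - f u" for v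
      using add[of "v - u" u] by simp
    ultimately show "bij_betw (\<lambda>v. v + u) {v \<in> W. f v = d} {v \<in> W. f v = c}"
      using W by (intro bij_betw_byWitness[where f' = "\<lambda>v. v - u"])
        (auto simp: add vec.subspace_add vec.subspace_diff)
  qed
  have "(\<Sum>v\<in>W. card {d \<in> UNIV. f v = d}) = (\<Sum>d\<in>UNIV. card {v \<in> W. f v = d})"
    by (rule sum_multicount_gen) auto
  also have "\<dots> = (\<Sum>d\<in>(UNIV :: 'a set). card {v \<in> W. f v = c})"
    by (rule sum.cong[OF refl eq])
  finally show ?thesis
    by simp
qed

lemma char_two_add_self:
  fixes x :: "'a::ring_1"
  assumes "(2 :: 'a) = 0"
  shows "x + x = 0"
  using assms by (metis mult_2 mult_zero_left)

section \<open>Zeros of a quadratic form\<close>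

locale quadratic_space =
  fixes Q :: "'a::{field,finite} ^ 'k \<Rightarrow> 'a" and q :: nat
  assumes quadratic: "quadratic_form Q"
    and q_def: "q = CARD('a)"
begin

abbreviation B :: "'a ^ 'k \<Rightarrow> 'a ^ 'k \<Rightarrow> 'a" where "B \<equiv> polar_form Q"

definition perp :: "('a ^ 'k) set \<Rightarrow> ('a ^ 'k) set" where
  "perp U = {v. \<forall>u\<in>U. B v u = 0}"

definition zeros :: "('a ^ 'k) set \<Rightarrow> ('a ^ 'k) set" where
  "zeros K = {v \<in> K. Q v = 0}"

lemma q_ge_2: "2 \<le> q"
  unfolding q_def by (rule two_le_CARD_field)

lemmas card_eq_power = card_subspace[where 'a='a and 'k='k, folded q_def]
lemmas dim_eqI = dim_eq_of_card[where 'a='a and 'k='k, folded q_def]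
lemmas card_fibre' = card_fibre[where 'a='a and 'k='k, folded q_def]

lemma Q_scale: "Q (c *s x) = c\<^sup>2 * Q x"
  and B_add_left: "B (x + x') y = B x y + B x' y"
  and B_scale_left: "B (c *s x) y = c * B x y"
  using quadratic by (auto simp: quadratic_form_def)

lemma B_sym: "B x y = B y x"
  by (simp add: polar_form_def add.commute)

lemma B_add_right: "B x (y + y') = B x y + B x y'"
  and B_scale_right: "B x (c *s y) = c * B x y"
  using B_add_left B_scale_left B_sym by metis+

lemma Q_add: "Q (x + y) = Q x + Q y + B x y"
  by (simp add: polar_form_def)

lemma Q_0 [simp]: "Q 0 = 0"
  using Q_scale[of 0 0] by simp

lemma B_0_left [simp]: "B 0 y = 0" and B_0_right [simp]: "B y 0 = 0"
  using B_scale_left[of 0 0 y] B_scale_right[of y 0 0] by simp_all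

lemma B_self: "B x x = 2 * Q x"
proof -
  have "x + x = 2 *s x" by (simp add: vec_eq_iff)
  then have "Q (x + x) = 4 * Q x" by (simp add: Q_scale)
  then show ?thesis by (simp add: polar_form_def)
qed

lemmas B_simps = B_add_left B_add_right B_scale_left B_scale_right

lemma subspace_perp: "vec.subspace (perp U)"
  by (auto simp: vec.subspace_def perp_def B_simps)

lemma perp_antimono: "U \<subseteq> W \<Longrightarrow> perp W \<subseteq> perp U"
  by (auto simp: perp_def)

lemma perp_span: "perp (vec.span U) = perp U"
proof
  show "perp (vec.span U) \<subseteq> perp U" by (simp add: perp_antimono vec.span_superset)
  show "perp U \<subseteq> perp (vec.span U)"
  proof
    fix v assume v: "v \<in> perp U"
    have "vec.subspace {u. B v u = 0}"
      by (auto simp: vec.subspace_def B_simps)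
    then have "vec.span U \<subseteq> {u. B v u = 0}"
      using v by (intro vec.span_minimal) (auto simp: perp_def)
    then show "v \<in> perp (vec.span U)" by (auto simp: perp_def)
  qed
qed

text \<open>Obtained without rank arguments by counting the pairs \<open>(w, u)\<close> with \<open>B w u = 0\<close> in two ways.\<close>
lemma card_perp:
  assumes W: "vec.subspace W" and U: "vec.subspace U"
    and nondeg: "\<And>u. u \<in> U \<Longrightarrow> (\<And>w. w \<in> W \<Longrightarrow> B w u = 0) \<Longrightarrow> u = 0"
  shows "card (W \<inter> perp U) * card U = card W"
proof -
  \<comment> \<open>The factor \<open>q\<close> on both counts avoids dividing \<open>card W\<close>
    and \<open>card U\<close> by \<open>q\<close>.\<close>
  have cW: "q * card {w \<in> W. B w u = 0} = (if u = 0 then q * card W else card W)" if "u \<in> U" for u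
  proof (cases "u = 0")
    case False
    then obtain w where "w \<in> W" "B w u \<noteq> 0" using nondeg \<open>u \<in> U\<close> by blast
    then show ?thesis using False card_fibre'[OF W, of "\<lambda>w. B w u" w 0] by (simp add: B_simps)
  qed simp
  have cU: "q * card {u \<in> U. B w u = 0} = (if w \<in> perp U then q * card U else card U)" for w
  proof (cases "w \<in> perp U")
    case True
    then have "{u \<in> U. B w u = 0} = U" by (auto simp: perp_def)
    then show ?thesis using True by simp
  next
    case False
    then obtain u where "u \<in> U" "B w u \<noteq> 0" by (auto simp: perp_def)
    then show ?thesis using False card_fibre'[OF U, of "\<lambda>u. B w u" u 0] by (simp add: B_simps)
  qed
  have U0: "0 \<in> U" using U by (rule vec.subspace_0)
  have "(\<Sum>w\<in>W. card {u \<in> U. B w u = 0}) = (\<Sum>u\<in>U. card {w \<in> W. B w u = 0})"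
    by (rule sum_multicount_gen) auto
  then have "(\<Sum>w\<in>W. q * card {u \<in> U. B w u = 0}) = (\<Sum>u\<in>U. q * card {w \<in> W. B w u = 0})"
    by (simp flip: sum_distrib_left)
  moreover have "(\<Sum>w\<in>W. q * card {u \<in> U. B w u = 0})
      = (\<Sum>w\<in>W. if w \<in> perp U then q * card U else card U)"
    by (rule sum.cong[OF refl cU])
  moreover have "(\<Sum>u\<in>U. q * card {w \<in> W. B w u = 0})
      = (\<Sum>u\<in>U. if u = 0 then q * card W else card W)"
    by (rule sum.cong[OF refl cW])
  ultimately have "(\<Sum>w\<in>W. if w \<in> perp U then q * card U else card U)
      = (\<Sum>u\<in>U. if u = 0 then q * card W else card W)"
    by simp
  moreover have "U \<inter> {u. u = 0} = {0}" "U \<inter> - {u. u = 0} = U - {0}"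
    using U0 by auto
  ultimately have E: "card (W \<inter> perp U) * (q * card U) + card (W - perp U) * card U
      = q * card W + card (U - {0}) * card W"
    by (simp add: sum.If_cases Diff_eq)
  have W': "int (card (W - perp U)) = int (card W) - int (card (W \<inter> perp U))"
    by (simp add: card_Diff_subset_Int card_mono of_nat_diff)
  have U': "int (card (U - {0})) = int (card U) - 1"
    using U0 card_Suc_Diff1[of U 0] by simp
  \<comment> \<open>The products \<open>card U * card W\<close> on the two sides of \<open>E\<close>
    cancel, and the rest has the common factor \<open>q - 1\<close>.\<close>
  from arg_cong[OF E, of int]
  have "(int q - 1) * (int (card (W \<inter> perp U)) * int (card U)) = (int q - 1) * int (card W)"
    unfolding of_nat_add of_nat_mult W' U' by (simp add: algebra_simps)
  then have "int (card (W \<inter> perp U)) * int (card U) = int (card W)"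
    using q_ge_2 by simp
  then show ?thesis
    by (simp only: of_nat_mult[symmetric] of_nat_eq_iff)
qed

text \<open>On a coset \<open>v + G\<close> outside \<open>perp G\<close> the form \<open>Q\<close> is a nonconstant affine function, so exactly one in
  \<open>q\<close> of its vectors is a zero.\<close>
lemma card_zeros:
  assumes K: "vec.subspace K" and G: "totally_singular Q G" "G \<subseteq> K"
    and maximal: "zeros (K \<inter> perp G) \<subseteq> G"
  shows "q * card (zeros K) + card (K \<inter> perp G) = q * card G + card K"
proof -
  have sG: "vec.subspace G" and QG: "\<And>u. u \<in> G \<Longrightarrow> Q u = 0"
    using G by (auto simp: totally_singular_def)
  have BG: "B u v = 0" if "u \<in> G" "v \<in> G" for u v
    using that QG[of "u + v"] QG sG by (simp add: polar_form_def vec.subspace_add)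
  have inner: "zeros (K \<inter> perp G) = G"
    using maximal G QG BG by (auto simp: zeros_def perp_def)
  let ?R = "K - perp G"
  \<comment> \<open>\<open>G\<close> lies in \<open>K\<close> and is orthogonal to itself, so
    translation by \<open>u\<close> permutes \<open>?R\<close>.\<close>
  have shift: "card {v \<in> ?R. Q (v + u) = 0} = card (zeros ?R)" if u: "u \<in> G" for u
  proof (rule bij_betw_same_card)
    have u': "- u \<in> G" using u sG by (simp add: vec.subspace_neg)
    have *: "v + w \<in> ?R" if "v \<in> ?R" "w \<in> G" for v w
      using that G BG K by (auto simp: perp_def B_simps vec.subspace_add subset_eq)
    show "bij_betw (\<lambda>v. v + u) {v \<in> ?R. Q (v + u) = 0} (zeros ?R)"
      by (rule bij_betw_byWitness[where f' = "\<lambda>v. v + - u"])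
        (use *[OF _ u] *[OF _ u'] in \<open>auto simp: zeros_def\<close>)
  qed
  have fib: "q * card {u \<in> G. Q (v + u) = 0} = card G" if v: "v \<in> ?R" for v
  proof -
    obtain u where u: "u \<in> G" "B v u \<noteq> 0" using v unfolding perp_def by blast
    have "Q (v + u) = 0 \<longleftrightarrow> B v u = - Q v" if "u \<in> G" for u
      using QG[OF that] by (simp add: Q_add eq_neg_iff_add_eq_0 add.commute[of "Q v"])
    then have "{u \<in> G. Q (v + u) = 0} = {u \<in> G. B v u = - Q v}"
      by auto
    then show ?thesis
      using u card_fibre'[OF sG, of "\<lambda>u. B v u" u "- Q v"] by (simp add: B_simps)
  qed
  have "(\<Sum>v\<in>?R. card {u \<in> G. Q (v + u) = 0}) = (\<Sum>u\<in>G. card {v \<in> ?R. Q (v + u) = 0})"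
    by (rule sum_multicount_gen) auto
  then have "(\<Sum>v\<in>?R. q * card {u \<in> G. Q (v + u) = 0}) = q * (\<Sum>u\<in>G. card {v \<in> ?R. Q (v + u) = 0})"
    by (simp only: sum_distrib_left[symmetric])
  also have "(\<Sum>u\<in>G. card {v \<in> ?R. Q (v + u) = 0}) = (\<Sum>u\<in>G. card (zeros ?R))"
    by (rule sum.cong[OF refl shift])
  finally have "(\<Sum>v\<in>?R. q * card {u \<in> G. Q (v + u) = 0}) = q * (card G * card (zeros ?R))"
    by simp
  then have "card ?R * card G = q * (card G * card (zeros ?R))"
    by (simp add: fib)
  moreover have "card G > 0" using vec.subspace_0[OF sG] by (auto simp: card_gt_0_iff)
  ultimately have 1: "card ?R = q * card (zeros ?R)" by auto
  have "zeros K = zeros ?R \<union> zeros (K \<inter> perp G)" "zeros ?R \<inter> zeros (K \<inter> perp G) = {}"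
    by (auto simp: zeros_def)
  then have 2: "card (zeros K) = card (zeros ?R) + card G"
    by (simp add: card_Un_disjoint inner)
  have "card K = card ?R + card (K \<inter> perp G)"
    by (subst card_Un_disjoint[symmetric]) (auto intro: arg_cong[where f = card])
  then show ?thesis using 1 2 by (simp add: algebra_simps)
qed

section \<open>Totally singular subspaces and the Witt index\<close>

lemma totally_singular_zero: "totally_singular Q {0}"
  by (auto simp: totally_singular_def vec.subspace_def)

lemma totally_singular_B:
  assumes "totally_singular Q G" "u \<in> G" "v \<in> G"
  shows "B u v = 0"
proof -
  have "u + v \<in> G" using assms by (auto simp: totally_singular_def vec.subspace_add)
  then show ?thesis using assms by (simp add: totally_singular_def polar_form_def)
qed

lemma totally_singular_subset_perp: "totally_singular Q G \<Longrightarrow> G \<subseteq> perp G"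
  unfolding perp_def by (blast intro: totally_singular_B)

text \<open>A vector of the new span is \<open>g + c *s v\<close> with \<open>g\<close> in
  \<open>G\<close>, and all three terms of \<open>Q_add\<close> vanish on it.\<close>

lemma totally_singular_insert:
  assumes G: "totally_singular Q G" and v: "Q v = 0" "v \<in> perp G"
  shows "totally_singular Q (vec.span (insert v G))"
  unfolding totally_singular_def
proof (intro conjI ballI)
  fix x assume "x \<in> vec.span (insert v G)"
  moreover have "vec.span G = G" using G by (simp add: totally_singular_def)
  ultimately obtain c where c: "x - c *s v \<in> G"
    using vec.span_breakdown_eq[of x v G] by auto
  have "B v (x - c *s v) = 0" using c v by (auto simp: perp_def)
  then have "B (x - c *s v) (c *s v) = 0"
    unfolding B_sym[of "x - c *s v"] by (simp only: B_scale_left mult_zero_right)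
  then have "Q ((x - c *s v) + c *s v) = 0"
    using c v G by (subst Q_add) (simp add: Q_scale totally_singular_def)
  then show "Q x = 0" by simp
qed simp

lemma totally_singular_span:
  assumes "Q v = 0"
  shows "totally_singular Q (vec.span {v})"
proof -
  have "Q x = 0" if "x \<in> vec.span {v}" for x
    using that assms by (auto simp: vec.span_singleton Q_scale)
  then show ?thesis by (simp add: totally_singular_def)
qed

text \<open>Generators relative to a subspace \<open>W\<close>, so that hyperplane sections can be
  counted in the same way as the whole quadric.\<close>

definition maximal_in :: "('a ^ 'k) set \<Rightarrow> ('a ^ 'k) set \<Rightarrow> bool" where
  "maximal_in W G \<longleftrightarrow> totally_singular Q G \<and> G \<subseteq> W \<and>
     (\<forall>U. totally_singular Q U \<longrightarrow> U \<subseteq> W \<longrightarrow> G \<subseteq> U \<longrightarrow> U = G)"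

lemma generator_iff_maximal_in: "generator Q G \<longleftrightarrow> maximal_in UNIV G"
  by (auto simp: generator_def maximal_in_def)

lemma ex_maximal_in:
  assumes "totally_singular Q U" "U \<subseteq> W"
  obtains G where "maximal_in W G" "U \<subseteq> G"
proof -
  have "finite {U. totally_singular Q U \<and> U \<subseteq> W}" by simp
  from finite_has_maximal2[OF this, of U] assms
  obtain G where "totally_singular Q G" "G \<subseteq> W" "U \<subseteq> G"
    "\<forall>U'\<in>{U. totally_singular Q U \<and> U \<subseteq> W}. G \<subseteq> U' \<longrightarrow> G = U'"
    by auto
  then show thesis
    by (intro that[of G]) (auto simp: maximal_in_def)
qed

text \<open>A zero of \<open>Q\<close> orthogonal to \<open>G\<close> but outside it would enlarge
  \<open>G\<close> inside \<open>W\<close>. This provides the hypothesis \<open>maximal\<close> of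
  \<open>card_zeros\<close>.\<close>

lemma maximal_in_zeros:
  assumes W: "vec.subspace W" and G: "maximal_in W G"
  shows "zeros (W \<inter> perp G) \<subseteq> G"
proof
  fix v assume v: "v \<in> zeros (W \<inter> perp G)"
  let ?U = "vec.span (insert v G)"
  have "totally_singular Q ?U"
    by (rule totally_singular_insert) (use v G in \<open>simp_all add: zeros_def maximal_in_def\<close>)
  moreover have "?U \<subseteq> W"
    by (rule vec.span_minimal) (use v G W in \<open>simp_all add: zeros_def maximal_in_def\<close>)
  moreover have "G \<subseteq> ?U" using vec.span_superset[of "insert v G"] by simp
  ultimately have "?U = G" using G unfolding maximal_in_def by blast
  then show "v \<in> G" using vec.span_base[of v "insert v G"] by auto
qed

text \<open>In characteristic 2 the polar form on \<open>W\<close> may have a radical, but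
  \<open>Q\<close> is nonzero on its nonzero vectors. Vectors of \<open>U\<close> are zeros of
  \<open>Q\<close>, so the nondegeneracy required by \<open>card_perp\<close> holds all the
  same.\<close>

lemma card_perp_totally_singular:
  assumes W: "vec.subspace W" "nonsingular_on W Q" and U: "totally_singular Q U" "U \<subseteq> W"
  shows "card (W \<inter> perp U) = q ^ (vec.dim W - vec.dim U)" and "vec.dim U \<le> vec.dim W"
proof -
  have sU: "vec.subspace U" using U by (simp add: totally_singular_def)
  show d: "vec.dim U \<le> vec.dim W" using U by (simp add: vec.dim_subset)
  have "u = 0" if "u \<in> U" and u: "\<And>w. w \<in> W \<Longrightarrow> B w u = 0" for u
  proof -
    have "B u w = 0" if "w \<in> W" for w
      using u[OF that] by (simp add: B_sym)
    then show ?thesis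
      using \<open>u \<in> U\<close> W U by (auto simp: nonsingular_on_def totally_singular_def)
  qed
  from card_perp[OF W(1) sU this]
  have "card (W \<inter> perp U) * q ^ vec.dim U = q ^ (vec.dim W - vec.dim U) * q ^ vec.dim U"
    using d by (simp add: card_eq_power sU W flip: power_add)
  then show "card (W \<inter> perp U) = q ^ (vec.dim W - vec.dim U)"
    using q_ge_2 by simp
qed

text \<open>An instance of \<open>card_zeros\<close>, since \<open>perp G\<close> is contained in
  \<open>perp U\<close>. Taking \<open>U\<close> to be zero counts the zeros in \<open>W\<close>,
  taking it to be a point counts those in a tangent hyperplane.\<close>

lemma card_zeros_perp:
  assumes W: "vec.subspace W" "nonsingular_on W Q"
    and G: "maximal_in W G" and U: "totally_singular Q U" "U \<subseteq> G"
  shows "q * card (zeros (W \<inter> perp U)) + q ^ (vec.dim W - vec.dim G)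
    = q ^ (vec.dim G + 1) + q ^ (vec.dim W - vec.dim U)"
proof -
  let ?K = "W \<inter> perp U"
  have G': "totally_singular Q G" "G \<subseteq> W" using G by (auto simp: maximal_in_def)
  have sub: "perp G \<subseteq> perp U" using U by (simp add: perp_antimono)
  then have K: "?K \<inter> perp G = W \<inter> perp G" by auto
  have "q * card (zeros ?K) + card (?K \<inter> perp G) = q * card G + card ?K"
  proof (rule card_zeros)
    show "vec.subspace ?K" using W subspace_perp by (simp add: vec.subspace_inter)
    show "G \<subseteq> ?K" using totally_singular_subset_perp[OF G'(1)] G' sub by auto
    show "zeros (?K \<inter> perp G) \<subseteq> G" unfolding K by (rule maximal_in_zeros[OF W(1) G])
  qed (rule G')
  then show ?thesis
    using card_perp_totally_singular(1)[OF W G'] card_perp_totally_singular(1)[OF W U(1)] U G'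
    by (simp add: K card_eq_power totally_singular_def)
qed

lemma perp_zero [simp]: "perp {0} = UNIV"
  by (simp add: perp_def)

lemma card_zeros_maximal_in:
  assumes W: "vec.subspace W" "nonsingular_on W Q" and G: "maximal_in W G"
  shows "q * card (zeros W) + q ^ (vec.dim W - vec.dim G) = q ^ (vec.dim G + 1) + q ^ vec.dim W"
proof -
  have "0 \<in> G" using G by (simp add: maximal_in_def totally_singular_def vec.subspace_0)
  then show ?thesis
    using card_zeros_perp[OF W G totally_singular_zero] by simp
qed

text \<open>By \<open>card_zeros_maximal_in\<close> the number of zeros is strictly increasing in \<open>vec.dim G\<close>, which replaces
  the appeal to Witt's theorem.\<close>
lemma dim_maximal_in_le:
  assumes W: "vec.subspace W" "nonsingular_on W Q" and G: "maximal_in W G" "maximal_in W G'"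
  shows "vec.dim G \<le> vec.dim G'"
proof (rule ccontr)
  assume "\<not> ?thesis"
  then have "q ^ (vec.dim G' + 1) < q ^ (vec.dim G + 1)"
    "q ^ (vec.dim W - vec.dim G) \<le> q ^ (vec.dim W - vec.dim G')"
    using q_ge_2 by (auto intro!: power_strict_increasing power_increasing)
  then show False
    using card_zeros_maximal_in[OF W G(1)] card_zeros_maximal_in[OF W G(2)] by linarith
qed

lemma dim_le_witt_index:
  assumes "totally_singular Q U" "U \<subseteq> W"
  shows "vec.dim U \<le> witt_index_on W Q"
  unfolding witt_index_on_def using assms by (intro Max_ge) auto

lemma ex_witt_index:
  assumes "vec.subspace W"
  obtains U where "totally_singular Q U" "U \<subseteq> W" "vec.dim U = witt_index_on W Q"
proof -
  have "{0} \<subseteq> W" using assms by (simp add: vec.subspace_0)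
  then have "witt_index_on W Q \<in> vec.dim ` {U. totally_singular Q U \<and> U \<subseteq> W}"
    unfolding witt_index_on_def using totally_singular_zero by (intro Max_in) auto
  then show thesis using that by auto
qed

text \<open>One maximal subspace contains a totally singular one of largest dimension, and all
  maximal ones have equal dimension. Maximality thus becomes a condition on the dimension, which can
  be transferred between a hyperplane and the whole space.\<close>

lemma maximal_in_iff:
  assumes W: "vec.subspace W" "nonsingular_on W Q"
  shows "maximal_in W G \<longleftrightarrow> totally_singular Q G \<and> G \<subseteq> W \<and> vec.dim G = witt_index_on W Q"
proof safe
  assume G: "maximal_in W G"
  then show "totally_singular Q G" "x \<in> G \<Longrightarrow> x \<in> W" for x by (auto simp: maximal_in_def)
  obtain U where U: "totally_singular Q U" "U \<subseteq> W" "vec.dim U = witt_index_on W Q"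
    using ex_witt_index[OF W(1)] .
  obtain G' where G': "maximal_in W G'" "U \<subseteq> G'" using ex_maximal_in[OF U(1,2)] .
  have "vec.dim U \<le> vec.dim G'" using G' by (simp add: vec.dim_subset)
  also have "\<dots> \<le> vec.dim G" by (rule dim_maximal_in_le[OF W G'(1) G])
  finally show "vec.dim G = witt_index_on W Q"
    using U dim_le_witt_index[of G W] G by (auto simp: maximal_in_def)
next
  assume G: "totally_singular Q G" "G \<subseteq> W" "vec.dim G = witt_index_on W Q"
  show "maximal_in W G" unfolding maximal_in_def
  proof (intro conjI allI impI)
    fix U assume U: "totally_singular Q U" "U \<subseteq> W" "G \<subseteq> U"
    then have "vec.dim U \<le> vec.dim G" using dim_le_witt_index[of U W] G by simp
    with U(3) have "vec.dim U = vec.dim G" using vec.dim_subset[OF U(3)] by simp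
    then have "card G = card U" using U G by (simp add: card_eq_power totally_singular_def)
    then show "U = G" using card_subset_eq[OF finite U(3)] by simp
  qed (use G in auto)
qed

text \<open>In characteristic 2 a nonzero radical vector \<open>z\<close> has \<open>Q z \<noteq> 0\<close>, so every coset of its line
  contains exactly one zero of \<open>Q\<close>. By \<open>card_zeros_maximal_in\<close> this forces \<open>vec.dim W\<close> to be odd.\<close>
lemma nonsingular_imp_nondegenerate:
  assumes W: "vec.subspace W" "nonsingular_on W Q" and even: "even (vec.dim W)"
    and z: "z \<in> W" "\<And>w. w \<in> W \<Longrightarrow> B w z = 0"
  shows "z = 0"
proof (rule ccontr)
  assume "z \<noteq> 0"
  have z': "B z w = 0" if "w \<in> W" for w using z(2)[OF that] by (simp add: B_sym)
  then have Qz: "Q z \<noteq> 0" using W \<open>z \<noteq> 0\<close> z by (auto simp: nonsingular_on_def)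
  then have two: "(2 :: 'a) = 0" using B_self[of z] z'[OF z(1)] by simp
  \<comment> \<open>In characteristic 2 the factors \<open>s + t\<close> and \<open>s - t\<close> of
    the difference of squares coincide.\<close>
  have "inj (\<lambda>t :: 'a. t\<^sup>2)"
  proof (rule injI)
    fix s t :: 'a assume "s\<^sup>2 = t\<^sup>2"
    moreover have "(s + t) * (s - t) = s\<^sup>2 - t\<^sup>2" 
      by (simp add: power2_eq_square algebra_simps)
    ultimately have "s + t = 0 \<or> s - t = 0" by simp
    moreover have "s + t = (s - t) + (t + t)" by simp
    ultimately show "s = t" unfolding char_two_add_self[OF two, of t] by simp
  qed
  then have bij: "bij (\<lambda>t :: 'a. t\<^sup>2)"
    by (simp add: bij_def finite_UNIV_inj_surj)
  have one: "card {t \<in> UNIV. Q (w + t *s z) = 0} = 1" if w: "w \<in> W" for w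
  proof -
    obtain t0 where t0: "t0\<^sup>2 = - Q w / Q z"
      using bij_is_surj[OF bij] by (metis surjD)
    have "Q (w + t *s z) = Q w + t\<^sup>2 * Q z" for t
      using z(2)[OF w] by (simp add: Q_add Q_scale B_scale_right)
    moreover have "Q w = - t0\<^sup>2 * Q z"
      using Qz by (simp add: t0)
    ultimately have "Q (w + t *s z) = (t\<^sup>2 - t0\<^sup>2) * Q z" for t
      by (simp add: left_diff_distrib)
    then have "Q (w + t *s z) = 0 \<longleftrightarrow> t\<^sup>2 = t0\<^sup>2" for t
      using Qz by simp
    then have "{t \<in> UNIV. Q (w + t *s z) = 0} = {t0}"
      using bij_is_inj[OF bij] by (auto dest: injD)
    then show ?thesis by simp
  qed
  have shift: "card {w \<in> W. Q (w + t *s z) = 0} = card (zeros W)" for t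
  proof (rule bij_betw_same_card)
    have tz: "t *s z \<in> W" using z W by (simp add: vec.subspace_scale)
    show "bij_betw (\<lambda>w. w + t *s z) {w \<in> W. Q (w + t *s z) = 0} (zeros W)"
      by (rule bij_betw_byWitness[where f' = "\<lambda>w. w - t *s z"])
        (use tz W in \<open>auto simp: zeros_def vec.subspace_add vec.subspace_diff\<close>)
  qed
  have "(\<Sum>w\<in>W. card {t \<in> UNIV. Q (w + t *s z) = 0}) = (\<Sum>t\<in>UNIV. card {w \<in> W. Q (w + t *s z) = 0})"
    by (rule sum_multicount_gen) auto
  then have Z: "card W = q * card (zeros W)"
    by (simp add: one[simplified] shift q_def)
  obtain G where G: "maximal_in W G"
    using ex_maximal_in[OF totally_singular_zero, of W] W by (auto simp: vec.subspace_0)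
  \<comment> \<open>By \<open>Z\<close> the terms \<open>q * card (zeros W)\<close> and
    \<open>q ^ vec.dim W\<close> cancel in \<open>card_zeros_maximal_in\<close>.\<close>
  have "q ^ (vec.dim W - vec.dim G) = q ^ (vec.dim G + 1)"
    using card_zeros_maximal_in[OF W G] Z by (simp add: card_eq_power W)
  then have "vec.dim W - vec.dim G = vec.dim G + 1"
    using q_ge_2 by (simp only: power_inject_exp)
  then have "vec.dim W = 2 * vec.dim G + 1" by simp
  then show False using even by simp
qed

section \<open>Counting the generators through a totally singular subspace\<close>

definition gens :: "('a ^ 'k) set \<Rightarrow> ('a ^ 'k) set \<Rightarrow> ('a ^ 'k) set set" where
  "gens W U = {G. maximal_in W G \<and> U \<subseteq> G}"

lemma gens_insert:
  assumes "totally_singular Q U"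
  shows "{G \<in> gens W U. v \<in> G} = gens W (vec.span (insert v U))"
proof -
  have "vec.span (insert v U) \<subseteq> G \<longleftrightarrow> v \<in> G \<and> U \<subseteq> G" if "maximal_in W G" for G
  proof
    assume "vec.span (insert v U) \<subseteq> G"
    then show "v \<in> G \<and> U \<subseteq> G" using vec.span_superset[of "insert v U"] by auto
  next
    assume "v \<in> G \<and> U \<subseteq> G"
    then show "vec.span (insert v U) \<subseteq> G"
      using that by (intro vec.span_minimal) (auto simp: maximal_in_def totally_singular_def)
  qed
  then show ?thesis unfolding gens_def by blast
qed

lemma subset_zeros_perp:
  assumes "totally_singular Q G" "U \<subseteq> G" "G \<subseteq> W"
  shows "G \<subseteq> zeros (W \<inter> perp U)"
  using totally_singular_subset_perp[OF assms(1)] perp_antimono[OF assms(2)] assms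
  by (auto simp: zeros_def totally_singular_def)

text \<open>Double counting of the pairs of a generator \<open>G\<close> through \<open>U\<close>
  and a vector \<open>v\<close> of \<open>G\<close> outside \<open>U\<close>. Such a
  \<open>v\<close> is always a zero of \<open>Q\<close> orthogonal to \<open>U\<close>.\<close>

lemma sum_card_gens:
  assumes W: "vec.subspace W" "nonsingular_on W Q" and U: "totally_singular Q U" "U \<subseteq> W"
  shows "(\<Sum>v\<in>zeros (W \<inter> perp U) - U. card (gens W (vec.span (insert v U))))
    = card (gens W U) * (q ^ witt_index_on W Q - q ^ vec.dim U)"
proof -
  let ?R = "zeros (W \<inter> perp U) - U"
  have "card {v \<in> ?R. v \<in> G} = q ^ witt_index_on W Q - q ^ vec.dim U" if "G \<in> gens W U" for G
  proof -
    have G: "totally_singular Q G" "G \<subseteq> W" "U \<subseteq> G" "vec.dim G = witt_index_on W Q"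
      using that maximal_in_iff[OF W] by (auto simp: gens_def)
    have "{v \<in> ?R. v \<in> G} = G - U" using subset_zeros_perp[OF G(1,3,2)] by auto
    then show ?thesis
      using G U by (simp add: card_Diff_subset card_eq_power totally_singular_def)
  qed
  then have "(\<Sum>G\<in>gens W U. card {v \<in> ?R. v \<in> G})
      = (\<Sum>G\<in>gens W U. q ^ witt_index_on W Q - q ^ vec.dim U)"
    by (rule sum.cong[OF refl])
  moreover have "(\<Sum>v\<in>?R. card {G \<in> gens W U. v \<in> G}) = (\<Sum>G\<in>gens W U. card {v \<in> ?R. v \<in> G})"
    by (rule sum_multicount_gen) auto
  ultimately show ?thesis by (simp add: gens_insert[OF U(1)])
qed

lemma gens_nonempty:
  assumes U: "totally_singular Q U" "U \<subseteq> W"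
  shows "card (gens W U) > 0"
proof -
  obtain G where "maximal_in W G" "U \<subseteq> G" using ex_maximal_in[OF U] .
  then have "G \<in> gens W U" by (simp add: gens_def)
  then show ?thesis by (auto simp: card_gt_0_iff)
qed

lemma dim_span_insert:
  assumes "totally_singular Q U" "v \<notin> U"
  shows "vec.dim (vec.span (insert v U)) = vec.dim U + 1"
proof -
  have "v \<notin> vec.span U"
    using assms vec.span_eq_iff[of U] unfolding totally_singular_def by blast
  then show ?thesis by (simp add: vec.dim_insert)
qed

lemma span_insert_subset:
  assumes "vec.subspace W" "U \<subseteq> W" "v \<in> W"
  shows "vec.span (insert v U) \<subseteq> W"
  by (rule vec.span_minimal) (use assms in auto)

lemma card_zeros_perp_eq:
  assumes W: "vec.subspace W" "nonsingular_on W Q" and U: "totally_singular Q U" "U \<subseteq> W"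
  shows "q * card (zeros (W \<inter> perp U)) + q ^ (vec.dim W - witt_index_on W Q)
    = q ^ (witt_index_on W Q + 1) + q ^ (vec.dim W - vec.dim U)"
proof -
  obtain G where G: "maximal_in W G" "U \<subseteq> G" using ex_maximal_in[OF U] .
  then have "vec.dim G = witt_index_on W Q" using maximal_in_iff[OF W] by simp
  then show ?thesis using card_zeros_perp[OF W G(1) U(1) G(2)] by simp
qed

text \<open>Downward induction on the dimension \<open>j\<close> of \<open>U\<close>. At the Witt
  index \<open>U\<close> is its own only generator; below it, \<open>sum_card_gens\<close> reduces
  to dimension \<open>j + 1\<close>, and the number of admissible \<open>v\<close> depends on
  \<open>j\<close> alone. No transitivity of an isometry group is involved.\<close>

lemma card_gens_cong:
  assumes W: "vec.subspace W" "nonsingular_on W Q"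
    and "totally_singular Q U" "U \<subseteq> W" "totally_singular Q U'" "U' \<subseteq> W" "vec.dim U = vec.dim U'"
  shows "card (gens W U) = card (gens W U')"
proof -
  let ?w = "witt_index_on W Q"
  have "\<exists>c. \<forall>U. totally_singular Q U \<and> U \<subseteq> W \<and> vec.dim U = j \<longrightarrow> card (gens W U) = c"
    if "j \<le> ?w" for j
    using that
  proof (induction j rule: inc_induct)
    case base
    have "gens W U = {U}" if U: "totally_singular Q U" "U \<subseteq> W" "vec.dim U = ?w" for U
    proof -
      have "maximal_in W U" using U maximal_in_iff[OF W] by simp
      then show ?thesis by (auto simp: gens_def maximal_in_def)
    qed
    then have "card (gens W U) = 1" if "totally_singular Q U \<and> U \<subseteq> W \<and> vec.dim U = ?w" for U
      using that by simp
    then show ?case by blast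
  next
    case (step j)
    then obtain c where
      c: "\<And>U. totally_singular Q U \<Longrightarrow> U \<subseteq> W \<Longrightarrow> vec.dim U = Suc j \<Longrightarrow> card (gens W U) = c"
      by blast
    have pos: "q ^ ?w - q ^ j > 0"
      using step q_ge_2 by (simp add: power_strict_increasing)
    \<comment> \<open>The number of zeros in \<open>W \<inter> perp U\<close> outside
      \<open>U\<close>, solved from \<open>card_zeros_perp_eq\<close>; the division by
      \<open>q\<close> is exact.\<close>
    define z where "z = (q ^ (?w + 1) + q ^ (vec.dim W - j) - q ^ (vec.dim W - ?w)) div q - q ^ j"
    have "card (gens W U) = (z * c) div (q ^ ?w - q ^ j)"
      if U: "totally_singular Q U" "U \<subseteq> W" "vec.dim U = j" for U
    proof -
      let ?R = "zeros (W \<inter> perp U) - U"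
      have "(\<Sum>v\<in>?R. card (gens W (vec.span (insert v U)))) = (\<Sum>v\<in>?R. c)"
      proof (rule sum.cong[OF refl c])
        fix v assume v: "v \<in> ?R"
        show "totally_singular Q (vec.span (insert v U))"
          by (rule totally_singular_insert) (use U v in \<open>simp_all add: zeros_def\<close>)
        show "vec.span (insert v U) \<subseteq> W"
          by (rule span_insert_subset) (use U W v in \<open>simp_all add: zeros_def\<close>)
        show "vec.dim (vec.span (insert v U)) = Suc j"
          using dim_span_insert[OF U(1), of v] U v by simp
      qed
      then have "card (gens W U) * (q ^ ?w - q ^ j) = card ?R * c"
        using sum_card_gens[OF W U(1,2)] U by simp
      moreover have "card ?R = z"
      proof -
        have "card ?R = card (zeros (W \<inter> perp U)) - q ^ j"
          using subset_zeros_perp[OF U(1) subset_refl U(2)] U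
          by (simp add: card_Diff_subset card_eq_power totally_singular_def)
        moreover have "q ^ (?w + 1) + q ^ (vec.dim W - j) - q ^ (vec.dim W - ?w)
            = q * card (zeros (W \<inter> perp U))"
          using card_zeros_perp_eq[OF W U(1,2)] U(3) by simp
        ultimately show ?thesis unfolding z_def using q_ge_2 by simp
      qed
      ultimately show ?thesis
        using pos by (metis nonzero_mult_div_cancel_right less_numeral_extra(3))
    qed
    then show ?case by blast
  qed
  moreover have "vec.dim U \<le> ?w" using assms by (simp add: dim_le_witt_index)
  ultimately show ?thesis using assms by metis
qed

lemma sum_card_gens_const:
  assumes W: "vec.subspace W" "nonsingular_on W Q" and U: "totally_singular Q U" "U \<subseteq> W"
    and U': "totally_singular Q U'" "U' \<subseteq> W" "vec.dim U' = vec.dim U + 1"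
  shows "card (zeros (W \<inter> perp U) - U) * card (gens W U')
    = card (gens W U) * (q ^ witt_index_on W Q - q ^ vec.dim U)"
proof -
  have "card (gens W (vec.span (insert v U))) = card (gens W U')"
    if v: "v \<in> zeros (W \<inter> perp U) - U" for v
  proof (rule card_gens_cong[OF W _ _ U'(1,2)])
    show "totally_singular Q (vec.span (insert v U))"
      by (rule totally_singular_insert) (use U v in \<open>simp_all add: zeros_def\<close>)
    show "vec.span (insert v U) \<subseteq> W"
      by (rule span_insert_subset) (use U W v in \<open>simp_all add: zeros_def\<close>)
    show "vec.dim (vec.span (insert v U)) = vec.dim U'"
      using dim_span_insert[OF U(1), of v] U' v by simp
  qed
  then show ?thesis using sum_card_gens[OF W U] by simp
qed

lemma ex_totally_singular_dim_one:
  assumes W: "vec.subspace W" and w: "witt_index_on W Q \<ge> 1"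
  obtains v where "v \<in> W" "v \<noteq> 0" "Q v = 0"
proof -
  obtain U where U: "totally_singular Q U" "U \<subseteq> W" "vec.dim U = witt_index_on W Q"
    using ex_witt_index[OF W] .
  then have "U \<noteq> {0}" using w by auto
  moreover have "0 \<in> U" using U by (simp add: totally_singular_def vec.subspace_0)
  ultimately obtain v where "v \<in> U" "v \<noteq> 0" by blast
  then show thesis using that U by (auto simp: totally_singular_def)
qed

lemma dim_singleton: "v \<noteq> 0 \<Longrightarrow> vec.dim (vec.span {v}) = 1"
  using vec.dim_insert[of v "{}"] by simp

lemma card_Diff_zero_zeros:
  assumes "0 \<in> W"
  shows "card (zeros W - {0}) = card (zeros W) - 1"
  using assms by (simp add: zeros_def)

text \<open>Count the pairs of a vector of \<open>S\<close> and a generator containing it: every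
  nonzero zero of \<open>Q\<close> in \<open>W\<close> lies in the same number \<open>?c\<close> of
  generators. The same count for all nonzero zeros, \<open>N\<close>, eliminates the unknown number
  of generators.\<close>

lemma card_inter_of_gens:
  assumes W: "vec.subspace W" "nonsingular_on W Q" and w: "witt_index_on W Q \<ge> 1"
    and S: "S \<subseteq> zeros UNIV - {0}" and M: "\<And>G. maximal_in W G \<Longrightarrow> card (S \<inter> G) = M"
  shows "card (S \<inter> W) * (q ^ witt_index_on W Q - 1) = M * (card (zeros W) - 1)"
proof -
  have W0: "0 \<in> W" using W by (simp add: vec.subspace_0)
  obtain v0 where v0: "v0 \<in> W" "v0 \<noteq> 0" "Q v0 = 0" using ex_totally_singular_dim_one[OF W(1) w] .
  let ?P = "vec.span {v0}" and ?O = "{0} :: ('a ^ 'k) set"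
  have P: "totally_singular Q ?P" "?P \<subseteq> W" "vec.dim ?P = vec.dim ?O + 1"
    using v0 W by (auto simp: totally_singular_span dim_singleton intro: vec.span_minimal[THEN subsetD])
  let ?c = "card (gens W ?P)"
  have c: "?c > 0" by (rule gens_nonempty[OF P(1,2)])
  have N: "(card (zeros W) - 1) * ?c = card (gens W ?O) * (q ^ witt_index_on W Q - 1)"
    using sum_card_gens_const[OF W totally_singular_zero _ P] W0 by (simp add: card_Diff_zero_zeros)
  have "(\<Sum>v\<in>S \<inter> W. card {G \<in> gens W ?O. v \<in> G}) = (\<Sum>G\<in>gens W ?O. card {v \<in> S \<inter> W. v \<in> G})"
    by (rule sum_multicount_gen) auto
  also have "\<dots> = (\<Sum>G\<in>gens W ?O. M)"
  proof (rule sum.cong[OF refl])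
    fix G assume "G \<in> gens W ?O"
    then have G: "maximal_in W G" "G \<subseteq> W" by (auto simp: gens_def maximal_in_def)
    then have "{v \<in> S \<inter> W. v \<in> G} = S \<inter> G" by auto
    then show "card {v \<in> S \<inter> W. v \<in> G} = M" using M[OF G(1)] by simp
  qed
  also have "(\<Sum>v\<in>S \<inter> W. card {G \<in> gens W ?O. v \<in> G}) = (\<Sum>v\<in>S \<inter> W. ?c)"
  proof (rule sum.cong[OF refl])
    fix v assume v: "v \<in> S \<inter> W"
    then have v': "Q v = 0" "v \<noteq> 0" "v \<in> W" using S by (auto simp: zeros_def)
    have "card (gens W (vec.span {v})) = ?c"
    proof (rule card_gens_cong[OF W _ _ P(1,2)])
      show "vec.span {v} \<subseteq> W" using v' W by (intro vec.span_minimal) auto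
    qed (use v' v0 in \<open>simp_all add: totally_singular_span dim_singleton\<close>)
    moreover have "vec.span (insert v ?O) = vec.span {v}"
      using vec.span_insert_0[of "{v}"] by (simp add: insert_commute)
    ultimately show "card {G \<in> gens W ?O. v \<in> G} = ?c"
      by (simp add: gens_insert[OF totally_singular_zero])
  qed
  finally have E: "card (S \<inter> W) * ?c = card (gens W ?O) * M" by simp
  have "card (S \<inter> W) * (q ^ witt_index_on W Q - 1) * ?c
      = card (S \<inter> W) * ?c * (q ^ witt_index_on W Q - 1)"
    by (simp only: ac_simps)
  also have "\<dots> = M * (card (gens W ?O) * (q ^ witt_index_on W Q - 1))"
    unfolding E by (simp only: ac_simps)
  also have "\<dots> = M * (card (zeros W) - 1) * ?c"
    by (simp only: N[symmetric] mult.assoc)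
  finally show ?thesis using c by auto
qed

text \<open>The count of \<open>card_inter_of_gens\<close>, restricted to the generators through the
  point \<open>P\<close>. Vectors of \<open>S\<close> on \<open>P\<close> lie in all of these, the
  others orthogonal to \<open>P\<close> lie in the constant number \<open>?c\<close>.\<close>

lemma card_inter_perp_of_gens:
  assumes W: "vec.subspace W" "nonsingular_on W Q" and w: "witt_index_on W Q \<ge> 2"
    and S: "S \<subseteq> zeros UNIV" and M: "\<And>G. maximal_in W G \<Longrightarrow> card (S \<inter> G) = M"
    and x: "x \<in> W" "x \<noteq> 0" "Q x = 0"
  defines "P \<equiv> vec.span {x}"
  shows "card (S \<inter> P) * (card (zeros (W \<inter> perp P)) - q)
      + card (S \<inter> W \<inter> perp P - P) * (q ^ witt_index_on W Q - q)
    = M * (card (zeros (W \<inter> perp P)) - q)"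
proof -
  have P: "totally_singular Q P" "P \<subseteq> W" "vec.dim P = 1"
    unfolding P_def using x W by (auto simp: totally_singular_span dim_singleton intro: vec.span_minimal[THEN subsetD])
  obtain G0 where G0: "maximal_in W G0" "P \<subseteq> G0" using ex_maximal_in[OF P(1,2)] .
  then have G0': "totally_singular Q G0" "G0 \<subseteq> W" "vec.dim G0 = witt_index_on W Q"
    using maximal_in_iff[OF W] by auto
  \<comment> \<open>Witt index at least 2 leaves room in \<open>G0\<close> for a totally singular
    line \<open>?L\<close> through \<open>P\<close>, which serves as the reference for
    \<open>?c\<close>.\<close>
  have "G0 \<noteq> P" using G0' P w by auto
  then obtain v0 where v0: "v0 \<in> G0" "v0 \<notin> P" using G0 by blast
  let ?L = "vec.span (insert v0 P)"
  have LG: "?L \<subseteq> G0" using G0' G0 v0 by (intro vec.span_minimal) (auto simp: totally_singular_def)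
  have L: "totally_singular Q ?L" "?L \<subseteq> W" "vec.dim ?L = vec.dim P + 1"
    using LG G0' dim_span_insert[OF P(1) v0(2)] by (auto simp: totally_singular_def)
  let ?c = "card (gens W ?L)" and ?N = "card (gens W P)"
  have c: "?c > 0" by (rule gens_nonempty[OF L(1,2)])
  have cardP: "card P = q" using P by (simp add: card_eq_power totally_singular_def)
  have Pz: "P \<subseteq> zeros (W \<inter> perp P)" by (rule subset_zeros_perp[OF P(1) subset_refl P(2)])
  have N: "(card (zeros (W \<inter> perp P)) - q) * ?c = ?N * (q ^ witt_index_on W Q - q)"
    using sum_card_gens_const[OF W P(1,2) L] Pz cardP P(3) by (simp add: card_Diff_subset)
  let ?T = "S \<inter> W \<inter> perp P"
  have "(\<Sum>v\<in>?T. card {G \<in> gens W P. v \<in> G}) = (\<Sum>G\<in>gens W P. card {v \<in> ?T. v \<in> G})"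
    by (rule sum_multicount_gen) auto
  also have "\<dots> = (\<Sum>G\<in>gens W P. M)"
  proof (rule sum.cong[OF refl])
    fix G assume "G \<in> gens W P"
    then have G: "maximal_in W G" "totally_singular Q G" "P \<subseteq> G" "G \<subseteq> W"
      by (auto simp: gens_def maximal_in_def)
    then have "{v \<in> ?T. v \<in> G} = S \<inter> G" using subset_zeros_perp[OF G(2-4)] by (auto simp: zeros_def)
    then show "card {v \<in> ?T. v \<in> G} = M" using M[OF G(1)] by simp
  qed
  also have "(\<Sum>v\<in>?T. card {G \<in> gens W P. v \<in> G})
      = (\<Sum>v\<in>S \<inter> P. card {G \<in> gens W P. v \<in> G}) + (\<Sum>v\<in>?T - P. card {G \<in> gens W P. v \<in> G})"
  proof -
    have "?T \<inter> P = S \<inter> P" using P Pz by (auto simp: zeros_def)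
    then show ?thesis using sum.Int_Diff[of ?T _ P] by simp
  qed
  also have "(\<Sum>v\<in>S \<inter> P. card {G \<in> gens W P. v \<in> G}) = (\<Sum>v\<in>S \<inter> P. ?N)"
  proof (rule sum.cong[OF refl])
    fix v assume "v \<in> S \<inter> P"
    then have "{G \<in> gens W P. v \<in> G} = gens W P" by (auto simp: gens_def)
    then show "card {G \<in> gens W P. v \<in> G} = ?N" by simp
  qed
  also have "(\<Sum>v\<in>?T - P. card {G \<in> gens W P. v \<in> G}) = (\<Sum>v\<in>?T - P. ?c)"
  proof (rule sum.cong[OF refl])
    fix v assume v: "v \<in> ?T - P"
    then have v': "Q v = 0" "v \<in> perp P" "v \<in> W" "v \<notin> P" using S by (auto simp: zeros_def)
    have "card (gens W (vec.span (insert v P))) = ?c"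
    proof (rule card_gens_cong[OF W _ _ L(1,2)])
      show "totally_singular Q (vec.span (insert v P))" by (rule totally_singular_insert[OF P(1) v'(1,2)])
      show "vec.span (insert v P) \<subseteq> W" by (rule span_insert_subset[OF W(1) P(2) v'(3)])
      show "vec.dim (vec.span (insert v P)) = vec.dim ?L" using dim_span_insert[OF P(1) v'(4)] L by simp
    qed
    then show "card {G \<in> gens W P. v \<in> G} = ?c" by (simp add: gens_insert[OF P(1)])
  qed
  finally have E: "card (S \<inter> P) * ?N + card (?T - P) * ?c = ?N * M" by simp
  have "(card (S \<inter> P) * (card (zeros (W \<inter> perp P)) - q)
      + card (?T - P) * (q ^ witt_index_on W Q - q)) * ?c
    = (card (S \<inter> P) * ?N + card (?T - P) * ?c) * (q ^ witt_index_on W Q - q)"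
    unfolding add_mult_distrib mult.assoc N by (simp only: ac_simps)
  also have "\<dots> = M * (card (zeros (W \<inter> perp P)) - q) * ?c"
    unfolding E mult.assoc N by (simp only: ac_simps)
  finally show ?thesis using c by auto
qed

end

section \<open>Elliptic quadrics and their ovoids\<close>

locale elliptic_space = quadratic_space Q q
  for Q :: "'a::{field,finite} ^ 'k \<Rightarrow> 'a" and q :: nat +
  fixes n :: nat
  assumes elliptic: "elliptic_on n UNIV Q" and n_ge_2: "2 \<le> n"
begin

declare vec.dim_UNIV [simp del]

lemma dim_V: "vec.dim (UNIV :: ('a ^ 'k) set) = 2 * n + 2"
  and nonsingular_V: "nonsingular_on UNIV Q"
  and witt_V: "witt_index_on UNIV Q = n"
  and subspace_V: "vec.subspace (UNIV :: ('a ^ 'k) set)"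
  using elliptic by (simp_all add: elliptic_on_def)

lemma card_V: "card (UNIV :: ('a ^ 'k) set) = q ^ (2 * n + 2)"
  using card_eq_power[OF subspace_V] dim_V by simp

text \<open>The even dimension excludes a radical in characteristic 2 as well.\<close>

lemma nondegenerate: "(\<And>w. B w z = 0) \<Longrightarrow> z = 0"
  using nonsingular_imp_nondegenerate[OF subspace_V nonsingular_V] dim_V by simp

lemma card_perp_V:
  assumes "vec.subspace U"
  shows "card (perp U) * card U = q ^ (2 * n + 2)"
  using card_perp[OF subspace_V assms] nondegenerate card_V by simp

text \<open>One inclusion is symmetry of \<open>B\<close>; the sizes agree because both sides
  multiply with \<open>card (perp U)\<close> to the size of the whole space.\<close>

lemma perp_perp:
  assumes "vec.subspace U"
  shows "perp (perp U) = U"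
proof -
  have "U \<subseteq> perp (perp U)" unfolding perp_def by (auto simp: B_sym)
  moreover have "card (perp (perp U)) * card (perp U) = card U * card (perp U)"
    using card_perp_V[OF assms] card_perp_V[OF subspace_perp, of U] by (simp add: mult.commute)
  moreover have "card (perp U) > 0"
    using vec.subspace_0[OF subspace_perp] by (auto simp: card_gt_0_iff)
  ultimately show ?thesis using card_subset_eq[OF finite, of U "perp (perp U)"] by auto
qed

lemma card_perp_singleton:
  assumes "x \<noteq> 0"
  shows "card (perp {x}) = q ^ (2 * n + 1)"
proof -
  have "card (perp {x}) * q = q ^ (2 * n + 1) * q"
    using card_perp_V[of "vec.span {x}"] assms q_ge_2
    by (auto simp: perp_span card_eq_power dim_singleton)
  then show ?thesis using q_ge_2 by auto
qed

text \<open>Reduces the later identities to polynomial identities in \<open>q ^ n\<close> and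
  \<open>q\<close>.\<close>

lemma powers_of_q:
  "int q ^ (n + 1) = int q ^ n * int q" "int q ^ (n + 2) = int q ^ n * (int q)\<^sup>2"
  "int q ^ (2 * n) = (int q ^ n)\<^sup>2" "int q ^ (2 * n + 1) = (int q ^ n)\<^sup>2 * int q"
  "int q ^ (2 * n + 2) = (int q ^ n)\<^sup>2 * (int q)\<^sup>2"
  by (simp_all add: power_add power2_eq_square mult_2)

lemma cancel_q: "int q * x = int q * y \<Longrightarrow> x = y"
  using q_ge_2 by simp

text \<open>With \<open>a = q ^ n\<close> this is \<open>1 + (a - 1) * (a * q + 1)\<close>: the zero
  vector and \<open>q - 1\<close> vectors for each point of the quadric.\<close>

lemma card_zeros_V: "int (card (zeros UNIV)) = (int q ^ n)\<^sup>2 * int q + int q ^ n - int q ^ n * int q"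
proof (rule cancel_q)
  have "2 * n + 2 - n = n + 2" by simp
  then have "int (q * card (zeros UNIV) + q ^ (n + 2)) = int (q ^ (n + 1) + q ^ (2 * n + 2))"
    using card_zeros_perp_eq[OF subspace_V nonsingular_V totally_singular_zero] dim_V witt_V
    by simp
  then show "int q * int (card (zeros UNIV))
      = int q * ((int q ^ n)\<^sup>2 * int q + int q ^ n - int q ^ n * int q)"
    unfolding of_nat_add of_nat_mult of_nat_power powers_of_q
    by (simp add: algebra_simps power2_eq_square)
qed

lemma zeros_V_pos: "card (zeros UNIV) \<ge> 1"
proof -
  have "0 \<in> zeros UNIV" by (simp add: zeros_def)
  then show ?thesis using card_gt_0_iff[of "zeros UNIV"] by (auto simp: Suc_le_eq)
qed

text \<open>With \<open>a = q ^ n\<close> this is \<open>q + (a - q) * (a + 1)\<close>, where the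
  summand \<open>q\<close> accounts for the point \<open>x\<close> itself.\<close>

lemma card_zeros_tangent:
  assumes "x \<noteq> 0" "Q x = 0"
  shows "int (card (zeros (perp {x}))) = (int q ^ n)\<^sup>2 + int q ^ n - int q ^ n * int q"
proof (rule cancel_q)
  have "2 * n + 2 - n = n + 2" "2 * n + 2 - 1 = 2 * n + 1" by simp_all
  then have "int (q * card (zeros (perp {x})) + q ^ (n + 2)) = int (q ^ (n + 1) + q ^ (2 * n + 1))"
    using card_zeros_perp_eq[OF subspace_V nonsingular_V totally_singular_span[OF assms(2)]]
    by (simp only: dim_V witt_V dim_singleton[OF assms(1)] perp_span Int_UNIV_left subset_UNIV simp_thms)
  then show "int q * int (card (zeros (perp {x})))
      = int q * ((int q ^ n)\<^sup>2 + int q ^ n - int q ^ n * int q)"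
    unfolding of_nat_add of_nat_mult of_nat_power powers_of_q
    by (simp add: algebra_simps power2_eq_square)
qed

section \<open>Hyperplanes orthogonal to a nonsingular point\<close>

text \<open>The radical of the hyperplane lies in the span of \<open>z\<close>, on which only 0 is a
  zero of \<open>Q\<close>. In characteristic 2 the vector \<open>z\<close> belongs to the radical,
  so nondegeneracy would be too much to ask.\<close>

lemma nonsingular_perp:
  assumes "Q z \<noteq> 0"
  shows "nonsingular_on (perp {z}) Q"
  unfolding nonsingular_on_def
proof (intro ballI impI)
  fix v assume v: "v \<in> perp {z}" "\<forall>w\<in>perp {z}. B v w = 0" "Q v = 0"
  then have "v \<in> perp (perp (vec.span {z}))" unfolding perp_span perp_def[of "perp {z}"] by simp
  then have "v \<in> vec.span {z}" by (simp add: perp_perp)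
  then obtain c where "v = c *s z" by (auto simp: vec.span_singleton)
  then show "v = 0" using v assms by (simp add: Q_scale)
qed

lemma dim_perp_singleton:
  assumes "x \<noteq> 0"
  shows "vec.dim (perp {x}) = 2 * n + 1"
  using dim_eqI[OF subspace_perp card_perp_singleton[OF assms]] .

lemma card_zeros_perp_witt:
  assumes "Q z \<noteq> 0"
  shows "q * card (zeros (perp {z})) + q ^ (2 * n + 1 - witt_index_on (perp {z}) Q)
    = q ^ (witt_index_on (perp {z}) Q + 1) + q ^ (2 * n + 1)"
proof -
  have z: "z \<noteq> 0" using assms by auto
  have "{0} \<subseteq> perp {z}" using vec.subspace_0[OF subspace_perp] by simp
  from card_zeros_perp_eq[OF subspace_perp nonsingular_perp[OF assms] totally_singular_zero this]
  show ?thesis by (simp add: dim_perp_singleton[OF z])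
qed

lemma witt_index_perp_le: "witt_index_on (perp {z}) Q \<le> n"
proof -
  obtain U where "totally_singular Q U" "vec.dim U = witt_index_on (perp {z}) Q"
    using ex_witt_index[OF subspace_perp] by blast
  then show ?thesis using dim_le_witt_index[of U UNIV] witt_V by simp
qed

text \<open>The bound \<open>Z(z\<^sup>\<bottom>) \<le> q ^ (2 * n)\<close> on the number of zeros follows from the Witt index being at
  most \<open>n\<close>; summing over all nonsingular \<open>z\<close> shows that it holds with equality on average.\<close>
lemma card_zeros_perp_nonsingular:
  assumes "Q z \<noteq> 0"
  shows "card (zeros (perp {z})) = q ^ (2 * n)"
proof -
  let ?N = "{z. Q z \<noteq> 0}"
  have le: "card (zeros (perp {z})) \<le> q ^ (2 * n)" if "Q z \<noteq> 0" for z
  proof -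
    have "q ^ (witt_index_on (perp {z}) Q + 1) \<le> q ^ (2 * n + 1 - witt_index_on (perp {z}) Q)"
      using witt_index_perp_le[of z] q_ge_2 by (intro power_increasing) auto
    moreover have "q ^ (2 * n + 1) = q * q ^ (2 * n)" by simp
    ultimately have "q * card (zeros (perp {z})) \<le> q * q ^ (2 * n)"
      using card_zeros_perp_witt[OF that] by linarith
    then show ?thesis using q_ge_2 by simp
  qed
  define a where "a = int q ^ n"
  have cN: "int (card ?N) = a\<^sup>2 * (int q)\<^sup>2 - int (card (zeros UNIV))"
  proof -
    have "?N = UNIV - zeros UNIV" by (auto simp: zeros_def)
    moreover have "card (zeros UNIV) \<le> card (UNIV :: ('a ^ 'k) set)" by (rule card_mono) auto
    ultimately show ?thesis
      by (simp only: card_Diff_subset[OF finite subset_UNIV] of_nat_diff card_V of_nat_power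
          powers_of_q a_def)
  qed
  have cv: "int (card {z \<in> ?N. v \<in> perp {z}}) = a\<^sup>2 * int q - (a\<^sup>2 + a - a * int q)"
    if v: "v \<in> zeros UNIV - {0}" for v
  proof -
    have "{z \<in> ?N. v \<in> perp {z}} = perp {v} - zeros (perp {v})"
      by (auto simp: perp_def zeros_def B_sym)
    moreover have "zeros (perp {v}) \<subseteq> perp {v}" by (auto simp: zeros_def)
    ultimately have "int (card {z \<in> ?N. v \<in> perp {z}}) = int (card (perp {v})) - int (card (zeros (perp {v})))"
      by (simp add: card_Diff_subset card_mono of_nat_diff)
    then show ?thesis
      using v card_zeros_tangent[of v] card_perp_singleton[of v]
      by (simp add: zeros_def powers_of_q a_def)
  qed
  have "(\<Sum>z\<in>?N. card {v \<in> zeros UNIV. v \<in> perp {z}}) = (\<Sum>v\<in>zeros UNIV. card {z \<in> ?N. v \<in> perp {z}})"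
    by (rule sum_multicount_gen) auto
  moreover have "{v \<in> zeros UNIV. v \<in> perp {z}} = zeros (perp {z})" for z
    by (auto simp: zeros_def)
  ultimately have "(\<Sum>z\<in>?N. int (card (zeros (perp {z})))) = (\<Sum>v\<in>zeros UNIV. int (card {z \<in> ?N. v \<in> perp {z}}))"
    by (simp flip: of_nat_sum)
  \<comment> \<open>The zero vector lies in every hyperplane, whereas \<open>cv\<close> is about
    nonzero \<open>v\<close>.\<close>
  also have "\<dots> = int (card {z \<in> ?N. 0 \<in> perp {z}}) + (\<Sum>v\<in>zeros UNIV - {0}. int (card {z \<in> ?N. v \<in> perp {z}}))"
    by (rule sum.remove) (auto simp: zeros_def)
  also have "{z \<in> ?N. 0 \<in> perp {z}} = ?N" by (auto simp: perp_def)
  also have "(\<Sum>v\<in>zeros UNIV - {0}. int (card {z \<in> ?N. v \<in> perp {z}}))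
      = (\<Sum>v\<in>zeros UNIV - {0}. a\<^sup>2 * int q - (a\<^sup>2 + a - a * int q))"
    by (rule sum.cong[OF refl cv])
  also have "\<dots> = (int (card (zeros UNIV)) - 1) * (a\<^sup>2 * int q - (a\<^sup>2 + a - a * int q))"
  proof -
    show ?thesis using zeros_V_pos by (simp add: card_Diff_zero_zeros of_nat_diff)
  qed
  also have "int (card ?N) + (int (card (zeros UNIV)) - 1) * (a\<^sup>2 * int q - (a\<^sup>2 + a - a * int q))
      = int (card ?N) * a\<^sup>2"
    unfolding cN card_zeros_V a_def[symmetric] by (simp add: algebra_simps power2_eq_square)
  also have "\<dots> = (\<Sum>z\<in>?N. int (q ^ (2 * n)))"
    by (simp add: powers_of_q a_def)
  finally have "(\<Sum>z\<in>?N. card (zeros (perp {z}))) = (\<Sum>z\<in>?N. q ^ (2 * n))"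
    by (simp only: of_nat_sum[symmetric] of_nat_eq_iff)
  \<comment> \<open>Termwise inequality together with equal sums forces equality in every
    term.\<close>
  then show ?thesis
    using sum_mono_inv[of "\<lambda>z. card (zeros (perp {z}))" ?N "\<lambda>z. q ^ (2 * n)" z] le assms by simp
qed

text \<open>Inserting the number of zeros into \<open>card_zeros_perp_witt\<close> leaves two equal
  powers of \<open>q\<close>. Hence the section still contains generators of the whole
  quadric.\<close>

lemma witt_index_perp_nonsingular:
  assumes "Q z \<noteq> 0"
  shows "witt_index_on (perp {z}) Q = n"
proof -
  let ?w = "witt_index_on (perp {z}) Q"
  have "q ^ (2 * n + 1 - ?w) = q ^ (?w + 1)"
    using card_zeros_perp_witt[OF assms] card_zeros_perp_nonsingular[OF assms] by simp
  then have "2 * n + 1 - ?w = ?w + 1" using q_ge_2 by (simp only: power_inject_exp)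
  then show ?thesis by simp
qed

section \<open>Ovoids and their hyperplane sections\<close>

text \<open>The vector counterpart of an \<open>m\<close>-ovoid, where \<open>M = (q - 1) * m\<close>.\<close>
definition ovoid_vectors :: "nat \<Rightarrow> ('a ^ 'k) set \<Rightarrow> bool" where
  "ovoid_vectors M S \<longleftrightarrow> S \<subseteq> zeros UNIV - {0} \<and> (\<forall>G. generator Q G \<longrightarrow> card (S \<inter> G) = M)"

lemma q_power_gt_1: "int q ^ n > 1" "int q ^ n > int q"
  using n_ge_2 q_ge_2 power_strict_increasing[of 1 n "int q"] by (auto intro!: one_less_power)

text \<open>\<open>card_inter_of_gens\<close> for the whole space, with the factor
  \<open>q ^ n - 1\<close> cancelled.\<close>

lemma card_ovoid:
  assumes "ovoid_vectors M S"
  shows "int (card S) = int M * (int q ^ n * int q + 1)"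
proof -
  define a where "a = int q ^ n"
  have a: "a > 1" using q_power_gt_1 by (simp add: a_def)
  have "card (S \<inter> UNIV) * (q ^ n - 1) = M * (card (zeros UNIV) - 1)"
    using card_inter_of_gens[OF subspace_V nonsingular_V, of S M] assms n_ge_2 witt_V
    by (simp add: ovoid_vectors_def generator_iff_maximal_in)
  then have "int (card S * (q ^ n - 1)) = int (M * (card (zeros UNIV) - 1))" by simp
  moreover have "int (q ^ n - 1) = a - 1" using q_ge_2 by (simp add: a_def of_nat_diff)
  moreover have "int (card (zeros UNIV) - 1) = (a - 1) * (a * int q + 1)"
  proof -
    show ?thesis using zeros_V_pos
      by (simp add: of_nat_diff card_zeros_V a_def algebra_simps power2_eq_square)
  qed
  ultimately have "int (card S) * (a - 1) = int M * (a * int q + 1) * (a - 1)"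
    by (simp add: ac_simps)
  then show ?thesis using a by (simp add: a_def)
qed

text \<open>The hyperplane has Witt index \<open>n\<close>, so its maximal totally singular
  subspaces are generators of the whole quadric and meet \<open>S\<close> in \<open>M\<close>
  vectors. Then \<open>card_inter_of_gens\<close> applies inside the hyperplane.\<close>

lemma card_ovoid_perp_nonsingular:
  assumes S: "ovoid_vectors M S" and z: "Q z \<noteq> 0"
  shows "int (card (S \<inter> perp {z})) = int M * (int q ^ n + 1)"
proof -
  define a where "a = int q ^ n"
  have a: "a > 1" using q_power_gt_1 by (simp add: a_def)
  note w = witt_index_perp_nonsingular[OF z]
  have "card (S \<inter> G) = M" if "maximal_in (perp {z}) G" for G
  proof -
    have "maximal_in UNIV G"
      using that w witt_V maximal_in_iff[OF subspace_perp nonsingular_perp[OF z]]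
        maximal_in_iff[OF subspace_V nonsingular_V] by simp
    then show ?thesis using S by (simp add: ovoid_vectors_def generator_iff_maximal_in)
  qed
  then have "card (S \<inter> perp {z}) * (q ^ n - 1) = M * (q ^ (2 * n) - 1)"
    using card_inter_of_gens[OF subspace_perp nonsingular_perp[OF z], of S M] S n_ge_2 w
      card_zeros_perp_nonsingular[OF z] by (simp add: ovoid_vectors_def)
  then have "int (card (S \<inter> perp {z}) * (q ^ n - 1)) = int (M * (q ^ (2 * n) - 1))" by simp
  moreover have "int (q ^ n - 1) = a - 1" using q_ge_2 by (simp add: a_def of_nat_diff)
  moreover have "int (q ^ (2 * n) - 1) = (a - 1) * (a + 1)"
  proof -
    have "int (q ^ (2 * n) - 1) = a\<^sup>2 - 1"
      using q_ge_2 by (simp add: of_nat_diff powers_of_q a_def)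
    then show ?thesis by (simp add: algebra_simps power2_eq_square)
  qed
  ultimately have "int (card (S \<inter> perp {z})) * (a - 1) = int M * (a + 1) * (a - 1)"
    by (simp add: ac_simps)
  then show ?thesis using a by (simp add: a_def)
qed

text \<open>In \<open>card_inter_perp_of_gens\<close> the factor \<open>q ^ n - q\<close> cancels,
  being positive for \<open>n \<ge> 2\<close>. Vectors of \<open>S\<close> on the point
  \<open>x\<close> have weight \<open>q ^ n + 1\<close> there but count once in the section, hence
  the correction by \<open>q ^ n\<close>.\<close>

lemma card_ovoid_tangent:
  assumes S: "ovoid_vectors M S" and x: "Q x = 0" "x \<noteq> 0"
  shows "int (card (S \<inter> perp {x}))
    = int M * (int q ^ n + 1) - int (card (S \<inter> vec.span {x})) * int q ^ n"
proof -
  let ?P = "vec.span {x}"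
  define a where "a = int q ^ n"
  have a: "a > int q" using q_power_gt_1 by (simp add: a_def)
  have S': "S \<subseteq> zeros UNIV" "\<And>G. maximal_in UNIV G \<Longrightarrow> card (S \<inter> G) = M"
    using S by (auto simp: ovoid_vectors_def generator_iff_maximal_in)
  have E: "card (S \<inter> ?P) * (card (zeros (perp {x})) - q) + card (S \<inter> perp {x} - ?P) * (q ^ n - q)
      = M * (card (zeros (perp {x})) - q)"
    using card_inter_perp_of_gens[OF subspace_V nonsingular_V _ S', of x] x n_ge_2
    by (simp add: witt_V perp_span)
  have 1: "int (q ^ n - q) = a - int q"
    using a by (simp add: a_def of_nat_diff flip: of_nat_power)
  have Z: "int (card (zeros (perp {x}))) = int q + (a - int q) * (a + 1)"
    using card_zeros_tangent[OF x(2,1)] by (simp add: a_def algebra_simps power2_eq_square)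
  have "0 \<le> (a - int q) * (a + 1)" using a by simp
  with Z have 2: "int (card (zeros (perp {x})) - q) = (a - int q) * (a + 1)"
    by simp
  have "int (card (S \<inter> ?P)) * ((a - int q) * (a + 1)) + int (card (S \<inter> perp {x} - ?P)) * (a - int q)
      = int M * ((a - int q) * (a + 1))"
    using arg_cong[OF E, of int] unfolding of_nat_add of_nat_mult 1 2 .
  then have "(int (card (S \<inter> ?P)) * (a + 1) + int (card (S \<inter> perp {x} - ?P))) * (a - int q)
      = (int M * (a + 1)) * (a - int q)"
    by (simp add: algebra_simps)
  then have "int (card (S \<inter> ?P)) * (a + 1) + int (card (S \<inter> perp {x} - ?P)) = int M * (a + 1)"
    using a by simp
  moreover have "card (S \<inter> perp {x}) = card (S \<inter> ?P) + card (S \<inter> perp {x} - ?P)"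
  proof -
    have "?P \<subseteq> perp {x}"
      using totally_singular_subset_perp[OF totally_singular_span[OF x(1)]] by (simp add: perp_span)
    then have "S \<inter> perp {x} = (S \<inter> ?P) \<union> (S \<inter> perp {x} - ?P)" by auto
    moreover have "card ((S \<inter> ?P) \<union> (S \<inter> perp {x} - ?P)) = card (S \<inter> ?P) + card (S \<inter> perp {x} - ?P)"
      by (rule card_Un_disjoint) auto
    ultimately show ?thesis by simp
  qed
  ultimately show ?thesis by (simp add: a_def algebra_simps)
qed

text \<open>Double counting over the hyperplanes through \<open>perp L\<close>, valid for any set
  \<open>S\<close>. A vector outside \<open>perp L\<close> is orthogonal to \<open>q - 1\<close>
  nonzero vectors of \<open>L\<close>, one inside to all \<open>(q - 1) + q * (q - 1)\<close> of
  them.\<close>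

lemma sum_pencil:
  assumes L: "vec.subspace L" "card L = q\<^sup>2"
  shows "(\<Sum>z\<in>L - {0}. int (card (S \<inter> perp {z})))
    = (int q - 1) * (int (card S) + int q * int (card (S \<inter> perp L)))"
proof -
  have L0: "0 \<in> L" using L by (simp add: vec.subspace_0)
  have cz: "int (card {z \<in> L - {0}. v \<in> perp {z}})
      = (int q - 1) + (if v \<in> perp L then int q * (int q - 1) else 0)" for v
  proof -
    have "{z \<in> L - {0}. v \<in> perp {z}} = {z \<in> L. B v z = 0} - {0}" by (auto simp: perp_def)
    moreover have "0 \<in> {z \<in> L. B v z = 0}" using L0 by simp
    ultimately have 1: "int (card {z \<in> L - {0}. v \<in> perp {z}}) = int (card {z \<in> L. B v z = 0}) - 1"
      using card_Suc_Diff1[of "{z \<in> L. B v z = 0}" 0] by simp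
    show ?thesis
    proof (cases "v \<in> perp L")
      case True
      then have "{z \<in> L. B v z = 0} = L" by (auto simp: perp_def)
      then show ?thesis using 1 L True by (simp add: power2_eq_square algebra_simps)
    next
      case False
      then obtain u where "u \<in> L" "B v u \<noteq> 0" by (auto simp: perp_def)
      then have "q * card {z \<in> L. B v z = 0} = q * q"
        using card_fibre'[OF L(1), of "B v" u 0] L by (simp add: B_simps power2_eq_square)
      then show ?thesis using 1 False q_ge_2 by simp
    qed
  qed
  have "(\<Sum>z\<in>L - {0}. card {v \<in> S. v \<in> perp {z}}) = (\<Sum>v\<in>S. card {z \<in> L - {0}. v \<in> perp {z}})"
    by (rule sum_multicount_gen) auto
  then have "(\<Sum>z\<in>L - {0}. int (card (S \<inter> perp {z}))) = (\<Sum>v\<in>S. int (card {z \<in> L - {0}. v \<in> perp {z}}))"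
    by (simp only: Int_def of_nat_sum[symmetric])
  also have "\<dots> = (\<Sum>v\<in>S. (int q - 1) + (if v \<in> perp L then int q * (int q - 1) else 0))"
    by (rule sum.cong[OF refl cz])
  also have "\<dots> = int (card S) * (int q - 1) + int (card (S \<inter> perp L)) * (int q * (int q - 1))"
    by (simp add: sum.distrib sum.If_cases)
  finally show ?thesis by (simp add: algebra_simps)
qed

section \<open>Hyperbolic pairs and elliptic sections\<close>

lemma sum_span_singleton:
  fixes f :: "('a ^ 'k) set \<Rightarrow> int"
  assumes "x \<noteq> 0"
  shows "(\<Sum>z\<in>vec.span {x} - {0}. f (perp {z})) = (int q - 1) * f (perp {x})"
proof -
  have "f (perp {z}) = f (perp {x})" if "z \<in> vec.span {x} - {0}" for z
  proof -
    from that obtain c where "z = c *s x" "c \<noteq> 0" by (auto simp: vec.span_singleton)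
    then have "perp {z} = perp {x}" by (auto simp: perp_def B_simps)
    then show ?thesis by simp
  qed
  then have "(\<Sum>z\<in>vec.span {x} - {0}. f (perp {z})) = (\<Sum>z\<in>vec.span {x} - {0}. f (perp {x}))"
    by (rule sum.cong[OF refl])
  moreover have "int (card (vec.span {x} - {0})) = int q - 1"
    using card_eq_power[of "vec.span {x}"] assms q_ge_2
    by (simp add: dim_singleton card_Diff_subset vec.span_zero of_nat_diff)
  ultimately show ?thesis by simp
qed

lemma span_pair: "vec.span {x, y} = {a *s x + b *s y | a b. True}"
proof (intro equalityI subsetI)
  fix v assume "v \<in> vec.span {x, y}"
  then obtain a where "v - a *s x \<in> vec.span {y}"
    using vec.span_breakdown_eq[of v x "{y}"] by auto
  then obtain b where "v - a *s x = b *s y" by (auto simp: vec.span_singleton)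
  then have "v = a *s x + b *s y" by (simp add: diff_eq_eq add.commute)
  then show "v \<in> {a *s x + b *s y | a b. True}" by blast
next
  fix v assume "v \<in> {a *s x + b *s y | a b. True}"
  then obtain a b where v: "v = a *s x + b *s y" by blast
  show "v \<in> vec.span {x, y}"
    unfolding v by (intro vec.span_add vec.span_scale vec.span_base) auto
qed

context
  fixes x y
  assumes x: "Q x = 0" and y: "Q y = 0" and xy: "B x y \<noteq> 0"
begin

lemma B_pair: "B x x = 0" "B y y = 0" "B y x = B x y"
  using x y B_self[of x] B_self[of y] B_sym[of x y] by simp_all

lemma pair_nonzero: "x \<noteq> 0" "y \<noteq> 0"
  using xy by auto

lemma card_span_pair: "card (vec.span {x, y}) = q\<^sup>2"
proof -
  have "B x v = 0" if "v \<in> vec.span {x}" for v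
    using that B_pair by (auto simp: vec.span_singleton B_simps)
  then have "y \<notin> vec.span {x}" using xy by blast
  then have "vec.dim {y, x} = 2"
    using dim_singleton[OF pair_nonzero(1)] by (simp add: vec.dim_insert)
  then show ?thesis by (simp add: card_eq_power insert_commute)
qed

lemma Q_pair: "Q (a *s x + b *s y) = a * b * B x y"
  using x y by (simp add: Q_add Q_scale B_simps)

lemma zeros_span_pair: "zeros (vec.span {x, y}) = vec.span {x} \<union> vec.span {y}"
proof -
  have "v \<in> vec.span {x} \<union> vec.span {y}" if "v \<in> zeros (vec.span {x, y})" for v
  proof -
    from that obtain a b where v: "v = a *s x + b *s y" and "Q v = 0"
      by (auto simp: zeros_def span_pair)
    then have "a = 0 \<or> b = 0" using Q_pair xy by simp
    then show ?thesis unfolding v by (auto simp: vec.span_singleton)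
  qed
  moreover have "vec.span {x} \<union> vec.span {y} \<subseteq> vec.span {x, y}"
    by (intro Un_least vec.span_mono) auto
  moreover have "Q v = 0" if "v \<in> vec.span {x} \<union> vec.span {y}" for v
    using that x y by (auto simp: vec.span_singleton Q_scale)
  ultimately show ?thesis unfolding zeros_def by blast
qed

lemma span_inter_pair: "vec.span {x} \<inter> vec.span {y} = {0}"
proof
  show "vec.span {x} \<inter> vec.span {y} \<subseteq> {0}"
  proof
    fix v assume v: "v \<in> vec.span {x} \<inter> vec.span {y}"
    obtain a where "v = a *s x" using v by (auto simp: vec.span_singleton)
    moreover obtain b where "v = b *s y" using v by (auto simp: vec.span_singleton)
    ultimately have "a *s x = b *s y" by simp
    then have "a * B x y = b * B y y" by (simp flip: B_scale_left)
    then show "v \<in> {0}" using \<open>v = a *s x\<close> xy B_pair by simp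
  qed
qed (simp add: vec.span_zero)

text \<open>In \<open>sum_pencil\<close> for the span of \<open>x\<close> and \<open>y\<close>, the
  points \<open>x\<close> and \<open>y\<close> give tangent hyperplanes with \<open>q - 1\<close>
  vectors each. The remaining \<open>(q - 1) * (q - 1)\<close> nonzero vectors are nonsingular. All
  hyperplane sections being known, the intersection with \<open>perp {x, y}\<close> is the only
  unknown.\<close>

lemma card_ovoid_perp_pair:
  assumes S: "ovoid_vectors M S"
  shows "int (card (S \<inter> perp {x, y})) = int M * (int q ^ (n - 1) + 1)
    - (int (card (S \<inter> vec.span {x})) + int (card (S \<inter> vec.span {y}))) * int q ^ (n - 1)"
proof -
  let ?L = "vec.span {x, y}" and ?X = "vec.span {x}" and ?Y = "vec.span {y}"
  let ?f = "\<lambda>U. int (card (S \<inter> U))"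
  define b where "b = int q ^ (n - 1)"
  have b: "int q ^ n = int q * b"
    using n_ge_2 power_Suc[of "int q" "n - 1"] by (simp add: b_def del: power_Suc)
  have q1: "int q - 1 \<noteq> 0" using q_ge_2 by simp
  have zL: "?X \<union> ?Y \<subseteq> ?L" using zeros_span_pair by (auto simp: zeros_def)
  have dec: "?L - {0} = (?X - {0}) \<union> (?Y - {0}) \<union> (?L - (?X \<union> ?Y))"
    using zL vec.span_zero by auto
  have cX: "card ?X = q" "card ?Y = q"
    using card_eq_power pair_nonzero by (simp_all add: dim_singleton)
  have cXY: "int (card (?X \<union> ?Y)) = 2 * int q - 1"
    using card_Un_Int[of ?X ?Y] cX by (simp add: span_inter_pair)
  have cR: "int (card (?L - (?X \<union> ?Y))) = (int q - 1)\<^sup>2"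
  proof -
    have "card (?X \<union> ?Y) \<le> card ?L" using zL by (intro card_mono) auto
    then have "int (card (?L - (?X \<union> ?Y))) = int (card ?L) - int (card (?X \<union> ?Y))"
      using zL by (simp only: card_Diff_subset[OF finite] of_nat_diff)
    then show ?thesis by (simp add: cXY card_span_pair power2_eq_square algebra_simps)
  qed
  have "(\<Sum>z\<in>?L - {0}. ?f (perp {z}))
      = (\<Sum>z\<in>(?X - {0}) \<union> (?Y - {0}). ?f (perp {z})) + (\<Sum>z\<in>?L - (?X \<union> ?Y). ?f (perp {z}))"
    unfolding dec by (rule sum.union_disjoint) auto
  also have "(\<Sum>z\<in>(?X - {0}) \<union> (?Y - {0}). ?f (perp {z}))
      = (\<Sum>z\<in>?X - {0}. ?f (perp {z})) + (\<Sum>z\<in>?Y - {0}. ?f (perp {z}))"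
    using span_inter_pair by (intro sum.union_disjoint) auto
  also have "(\<Sum>z\<in>?L - (?X \<union> ?Y). ?f (perp {z})) = (\<Sum>z\<in>?L - (?X \<union> ?Y). int M * (int q ^ n + 1))"
  proof (rule sum.cong[OF refl])
    fix z assume "z \<in> ?L - (?X \<union> ?Y)"
    then have "Q z \<noteq> 0" using zeros_span_pair by (auto simp: zeros_def)
    then show "?f (perp {z}) = int M * (int q ^ n + 1)" by (rule card_ovoid_perp_nonsingular[OF S])
  qed
  finally have "(int q - 1) * (int (card S) + int q * ?f (perp {x, y}))
      = (int q - 1) * ?f (perp {x}) + (int q - 1) * ?f (perp {y}) + (int q - 1)\<^sup>2 * (int M * (int q ^ n + 1))"
    using sum_pencil[OF vec.subspace_span card_span_pair, of S]
      sum_span_singleton[OF pair_nonzero(1), of ?f] sum_span_singleton[OF pair_nonzero(2), of ?f] cR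
    by (simp add: perp_span)
  then have "(int q - 1) * (int (card S) + int q * ?f (perp {x, y}))
      = (int q - 1) * (?f (perp {x}) + ?f (perp {y}) + (int q - 1) * (int M * (int q ^ n + 1)))"
    by (simp add: power2_eq_square algebra_simps)
  then have "int (card S) + int q * ?f (perp {x, y})
      = ?f (perp {x}) + ?f (perp {y}) + (int q - 1) * (int M * (int q ^ n + 1))"
    using q1 by simp
  then have "int q * ?f (perp {x, y}) = int q * (int M * (b + 1) - (?f ?X + ?f ?Y) * b)"
    unfolding card_ovoid[OF S] card_ovoid_tangent[OF S x pair_nonzero(1)]
      card_ovoid_tangent[OF S y pair_nonzero(2)] b
    by (simp add: algebra_simps)
  then show ?thesis unfolding b_def by (rule cancel_q)
qed

text \<open>The radical of \<open>perp {x, y}\<close> lies in the span of \<open>x\<close> and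
  \<open>y\<close>, where orthogonality to both leaves only 0. For the Witt index, adjoining
  \<open>x\<close> gives the upper bound, and cutting a generator through \<open>x\<close> with
  \<open>perp {y}\<close> gives the lower one.\<close>

lemma elliptic_perp_pair: "elliptic_on (n - 1) (perp {x, y}) Q"
proof -
  let ?W = "perp {x, y}"
  have sW: "vec.subspace ?W" by (rule subspace_perp)
  have "card ?W * q\<^sup>2 = q ^ (2 * n) * q\<^sup>2"
    using card_perp_V[OF vec.subspace_span, of "{x, y}"] card_span_pair
    by (auto simp: perp_span power2_eq_square)
  then have "card ?W = q ^ (2 * n)" using q_ge_2 by simp
  then have "vec.dim ?W = 2 * n" by (rule dim_eqI[OF sW])
  then have dim: "vec.dim ?W = 2 * (n - 1) + 2" using n_ge_2 by simp
  have ns: "nonsingular_on ?W Q"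
    unfolding nonsingular_on_def
  proof (intro ballI impI)
    fix w assume w: "w \<in> ?W" "\<forall>v\<in>?W. B w v = 0"
    then have "w \<in> perp (perp (vec.span {x, y}))" unfolding perp_span perp_def[of "perp {x, y}"] by simp
    then have "w \<in> vec.span {x, y}" by (simp add: perp_perp)
    then obtain a b where ab: "w = a *s x + b *s y" by (auto simp: span_pair)
    have "B w x = 0" "B w y = 0" using w by (auto simp: perp_def)
    then have "a = 0" "b = 0" using xy by (simp_all add: ab B_simps B_pair)
    then show "w = 0" by (simp add: ab)
  qed
  have "witt_index_on ?W Q = n - 1"
  proof (rule antisym)
    obtain U where U: "totally_singular Q U" "U \<subseteq> ?W" "vec.dim U = witt_index_on ?W Q"
      using ex_witt_index[OF sW] .
    \<comment> \<open>\<open>U\<close> is orthogonal to \<open>y\<close>, but \<open>x\<close> is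
      not.\<close>
    have xU: "x \<notin> U" "x \<in> perp U"
      using U xy by (auto simp: perp_def B_sym subset_eq)
    have "vec.dim (vec.span (insert x U)) \<le> n"
      using dim_le_witt_index[OF totally_singular_insert[OF U(1) x xU(2)] subset_UNIV] witt_V by simp
    then show "witt_index_on ?W Q \<le> n - 1"
      unfolding dim_span_insert[OF U(1) xU(1)] U(3) by simp
  next
    obtain G where G: "maximal_in UNIV G" "vec.span {x} \<subseteq> G"
      using ex_maximal_in[OF totally_singular_span[OF x], of UNIV] by auto
    then have G': "totally_singular Q G" "vec.dim G = n" "x \<in> G"
      using maximal_in_iff[OF subspace_V nonsingular_V] witt_V vec.span_base[of x "{x}"] by auto
    have sG: "vec.subspace G" using G' by (simp add: totally_singular_def)
    let ?U = "{v \<in> G. B v y = 0}"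
    \<comment> \<open>The vector \<open>x\<close> of \<open>G\<close> shows that
      \<open>B v y\<close> is not identically zero on \<open>G\<close>, so exactly one dimension is
      lost.\<close>
    have "q * card ?U = q ^ n"
      using card_fibre'[OF sG, of "\<lambda>v. B v y" x 0] xy G' sG by (simp add: B_simps card_eq_power)
    also have "\<dots> = q * q ^ (n - 1)" using n_ge_2 by (simp flip: power_Suc)
    finally have "card ?U = q ^ (n - 1)" using q_ge_2 by simp
    moreover have "totally_singular Q ?U"
      using G' unfolding totally_singular_def by (auto simp: vec.subspace_def B_simps)
    moreover have "?U \<subseteq> ?W" using totally_singular_B[OF G'(1) _ G'(3)] by (auto simp: perp_def)
    ultimately show "n - 1 \<le> witt_index_on ?W Q"
      using dim_le_witt_index[of ?U ?W] dim_eqI[of ?U "n - 1"] by (simp add: totally_singular_def)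
  qed
  then show ?thesis using sW dim ns by (simp add: elliptic_on_def)
qed

end

text \<open>If \<open>perp W\<close> had no singular vector, all hyperplanes through \<open>W\<close> would be parabolic, and
  \<open>sum_pencil\<close> applied to all zeros of \<open>Q\<close> would be violated.\<close>
lemma elliptic_on_imp_pair:
  assumes W: "elliptic_on (n - 1) W Q"
  obtains x y where "Q x = 0" "Q y = 0" "B x y \<noteq> 0" "W = perp {x, y}"
proof -
  have sW: "vec.subspace W" and dW: "vec.dim W = 2 * n" and nW: "nonsingular_on W Q"
    and wW: "witt_index_on W Q = n - 1"
    using W n_ge_2 by (simp_all add: elliptic_on_def)
  let ?L = "perp W"
  have sL: "vec.subspace ?L" by (rule subspace_perp)
  have "card ?L * q ^ (2 * n) = q\<^sup>2 * q ^ (2 * n)"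
    using card_perp_V[OF sW] by (simp only: card_eq_power[OF sW] dW power_add mult.commute)
  then have cL: "card ?L = q\<^sup>2" using q_ge_2 by simp
  have pL: "perp ?L = W" by (rule perp_perp[OF sW])
  have "\<exists>x\<in>?L. x \<noteq> 0 \<and> Q x = 0"
  proof (rule ccontr)
    assume "\<not> ?thesis"
    then have Q: "Q z \<noteq> 0" if "z \<in> ?L - {0}" for z using that by auto
    have z: "int (card (zeros UNIV \<inter> perp {z})) = int (q ^ (2 * n))" if "z \<in> ?L - {0}" for z
    proof -
      have "zeros UNIV \<inter> perp {z} = zeros (perp {z})" by (auto simp: zeros_def)
      then show ?thesis using card_zeros_perp_nonsingular[OF Q[OF that]] by simp
    qed
    define a where "a = int q ^ n"
    have "(int q - 1) * (int (card (zeros UNIV)) + int q * int (card (zeros UNIV \<inter> perp ?L)))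
        = (\<Sum>z\<in>?L - {0}. int (q ^ (2 * n)))"
      unfolding sum_pencil[OF sL cL, symmetric] by (rule sum.cong[OF refl z])
    also have "\<dots> = ((int q)\<^sup>2 - 1) * a\<^sup>2"
      using vec.subspace_0[OF sL] cL q_ge_2
      by (simp add: card_Diff_subset of_nat_diff powers_of_q a_def)
    also have "\<dots> = (int q - 1) * ((int q + 1) * a\<^sup>2)"
      by (simp add: power2_eq_square algebra_simps)
    finally have "int (card (zeros UNIV)) + int q * int (card (zeros UNIV \<inter> perp ?L)) = (int q + 1) * a\<^sup>2"
      using q_ge_2 by simp
    moreover have "zeros UNIV \<inter> perp ?L = zeros W" unfolding pL by (auto simp: zeros_def)
    moreover have "int q * int (card (zeros W)) = a + a\<^sup>2 - a * int q"
    proof -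
      have "2 * n - (n - 1) = n + 1" "n - 1 + 1 = n" using n_ge_2 by simp_all
      then have "q * card (zeros W) + q ^ (n + 1) = q ^ n + q ^ (2 * n)"
        using card_zeros_perp_eq[OF sW nW totally_singular_zero] vec.subspace_0[OF sW]
        by (simp add: dW wW)
      then have "int (q * card (zeros W) + q ^ (n + 1)) = int (q ^ n + q ^ (2 * n))" by simp
      then show ?thesis unfolding of_nat_add of_nat_mult of_nat_power powers_of_q a_def by simp
    qed
    \<comment> \<open>The two zero counts, for the whole space and for \<open>W\<close>, exceed the
      pencil total by a negative amount, namely minus this product.\<close>
    ultimately have "2 * (a * (int q - 1)) = 0"
      unfolding card_zeros_V a_def[symmetric] by (simp add: algebra_simps)
    then show False using q_ge_2 by (simp add: a_def)
  qed
  then obtain x where x: "x \<in> ?L" "x \<noteq> 0" "Q x = 0" by blast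
  \<comment> \<open>Otherwise \<open>x\<close> would lie in \<open>perp ?L = W\<close> and in
    \<open>perp W\<close>, a singular radical vector of \<open>W\<close>.\<close>
  have "\<exists>y\<in>?L. B x y \<noteq> 0"
  proof (rule ccontr)
    assume "\<not> ?thesis"
    then have "x \<in> perp ?L" unfolding perp_def[of ?L] by blast
    then have "x \<in> W" by (simp add: pL)
    moreover have "\<forall>w\<in>W. B x w = 0" using x by (simp add: perp_def)
    ultimately show False using nW x by (auto simp: nonsingular_on_def)
  qed
  then obtain y' where y': "y' \<in> ?L" "B x y' \<noteq> 0" by blast
  \<comment> \<open>Chosen so that \<open>Q (y' + c *s x) = Q y' + c * B x y'\<close> vanishes; the
    value \<open>B x y'\<close> is unchanged because \<open>B x x = 0\<close>.\<close>
  define c where "c = - (Q y' / B x y')"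
  define y where "y = y' + c *s x"
  have Bxx: "B x x = 0" using B_self[of x] x by simp
  have y: "y \<in> ?L" using y' x sL by (simp add: y_def vec.subspace_add vec.subspace_scale)
  have xy: "B x y \<noteq> 0" using y' by (simp add: y_def B_simps Bxx)
  have "Q y = Q y' + c * B y' x" using x by (simp add: y_def Q_add Q_scale B_simps)
  also have "B y' x = B x y'" by (rule B_sym)
  also have "Q y' + c * B x y' = 0" using y' by (simp add: c_def)
  finally have Qy: "Q y = 0" .
  have "vec.span {x, y} \<subseteq> ?L" using x y sL by (intro vec.span_minimal) auto
  then have "vec.span {x, y} = ?L"
    using card_span_pair[OF x(3) Qy xy] cL by (intro card_subset_eq) auto
  then have "W = perp {x, y}" using pL perp_span by metis
  then show thesis using that x Qy xy by blast
qed

text \<open>If \<open>S\<close> lay in \<open>perp {x}\<close>, then \<open>card_ovoid\<close> and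
  \<open>card_ovoid_tangent\<close> would give the same number, but the first exceeds the second
  once \<open>M > 0\<close>.\<close>

lemma ex_ovoid_not_perp:
  assumes S: "ovoid_vectors M S" "S \<noteq> {}" and x: "Q x = 0" "x \<noteq> 0"
  obtains y where "y \<in> S" "B x y \<noteq> 0"
proof (rule ccontr)
  assume no: "\<not> thesis"
  have "S \<inter> perp {x} = S"
    using no that by (auto simp: perp_def B_sym)
  then have E: "int M * (int q ^ n * int q + 1)
      = int M * (int q ^ n + 1) - int (card (S \<inter> vec.span {x})) * int q ^ n"
    using card_ovoid[OF S(1)] card_ovoid_tangent[OF S(1) x] by simp
  have "int (card S) > 0" using S by (simp add: card_gt_0_iff)
  then have "M > 0" using card_ovoid[OF S(1)] by (cases "M = 0") auto
  moreover have "int q ^ n * 1 < int q ^ n * int q"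
    using q_ge_2 by (intro mult_strict_left_mono) auto
  ultimately have "int M * (int q ^ n + 1) < int M * (int q ^ n * int q + 1)"
    by simp
  moreover have "int (card (S \<inter> vec.span {x})) * int q ^ n \<ge> 0" by simp
  ultimately show False using E by linarith
qed

text \<open>Makes \<open>ex_ovoid_not_perp\<close> available for singular points outside the
  ovoid.\<close>

lemma ovoid_vectors_complement:
  assumes S: "ovoid_vectors M S"
  shows "ovoid_vectors (q ^ n - 1 - M) (zeros UNIV - {0} - S)"
  unfolding ovoid_vectors_def
proof (intro conjI allI impI)
  fix G assume gen: "generator Q G"
  then have G: "totally_singular Q G" "vec.dim G = n"
    using maximal_in_iff[OF subspace_V nonsingular_V] witt_V by (auto simp: generator_iff_maximal_in)
  have G0: "0 \<in> G" using G by (simp add: totally_singular_def vec.subspace_0)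
  have "(zeros UNIV - {0} - S) \<inter> G = (G - {0}) - (S \<inter> G)"
    using G by (auto simp: zeros_def totally_singular_def)
  moreover have "S \<inter> G \<subseteq> G - {0}" using S by (auto simp: ovoid_vectors_def)
  moreover have "card (S \<inter> G) = M" using S gen by (simp add: ovoid_vectors_def)
  moreover have "card (G - {0}) = q ^ n - 1"
    using G G0 by (simp add: card_eq_power totally_singular_def)
  ultimately show "card ((zeros UNIV - {0} - S) \<inter> G) = q ^ n - 1 - M"
    by (simp add: card_Diff_subset)
qed auto

section \<open>From vectors to projective points\<close>

text \<open>Replacing points by their nonzero vectors multiplies every count by
  \<open>q - 1\<close>.\<close>

definition vectors_of :: "('a ^ 'k) set set \<Rightarrow> ('a ^ 'k) set" where
  "vectors_of X = {v. v \<noteq> 0 \<and> vec.span {v} \<in> X}"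

lemma span_singleton_in_points_of:
  assumes "vec.subspace U" "v \<noteq> 0"
  shows "vec.span {v} \<in> points_of U \<longleftrightarrow> v \<in> U"
proof
  assume "vec.span {v} \<in> points_of U"
  then show "v \<in> U" using vec.span_base[of v "{v}"] by (auto simp: points_of_def)
next
  assume "v \<in> U"
  then show "vec.span {v} \<in> points_of U"
    using assms vec.span_minimal[of "{v}" U] by (simp add: points_of_def dim_singleton)
qed

lemma points_of_eq_span:
  fixes P :: "('a ^ 'k) set"
  assumes "P \<in> points_of U" "v \<in> P" "v \<noteq> 0"
  shows "vec.span {v} = P"
proof (rule card_subset_eq)
  show "vec.span {v} \<subseteq> P"
    using assms by (intro vec.span_minimal) (auto simp: points_of_def)
  show "card (vec.span {v}) = card P"
    using assms dim_singleton[of v] by (simp add: points_of_def card_eq_power)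
qed simp

text \<open>Distinct points share only the zero vector, and a point with a nonzero vector in
  \<open>U\<close> lies in \<open>U\<close>.\<close>

lemma card_vectors_of:
  assumes X: "X \<subseteq> points_of UNIV" and U: "vec.subspace U"
  shows "card (vectors_of X \<inter> U) = (q - 1) * card (X \<inter> points_of U)"
proof -
  let ?Y = "X \<inter> points_of U"
  have eq: "vectors_of X \<inter> U = (\<Union>P\<in>?Y. P - {0})"
  proof (intro equalityI subsetI)
    fix v assume "v \<in> vectors_of X \<inter> U"
    then have v: "v \<noteq> 0" "vec.span {v} \<in> X" "v \<in> U" by (auto simp: vectors_of_def)
    then have "vec.span {v} \<in> ?Y" by (simp add: span_singleton_in_points_of[OF U])
    moreover have "v \<in> vec.span {v} - {0}" using v vec.span_base[of v "{v}"] by simp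
    ultimately show "v \<in> (\<Union>P\<in>?Y. P - {0})" by blast
  next
    fix v assume "v \<in> (\<Union>P\<in>?Y. P - {0})"
    then obtain P where P: "P \<in> ?Y" "v \<in> P" "v \<noteq> 0" by blast
    then have "vec.span {v} = P" by (intro points_of_eq_span[of P U]) auto
    then show "v \<in> vectors_of X \<inter> U" using P by (auto simp: vectors_of_def points_of_def)
  qed
  have "card (\<Union>P\<in>?Y. P - {0}) = (\<Sum>P\<in>?Y. card (P - {0}))"
  proof (rule card_UN_disjoint)
    show "\<forall>P\<in>?Y. \<forall>P'\<in>?Y. P \<noteq> P' \<longrightarrow> (P - {0}) \<inter> (P' - {0}) = {}"
    proof (intro ballI impI)
      fix P P' assume P: "P \<in> ?Y" "P' \<in> ?Y" "P \<noteq> P'"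
      show "(P - {0}) \<inter> (P' - {0}) = {}"
      proof (rule ccontr)
        assume "\<not> ?thesis"
        then obtain v where "v \<in> P" "v \<in> P'" "v \<noteq> 0" by blast
        then show False using P points_of_eq_span[of P U v] points_of_eq_span[of P' U v] by auto
      qed
    qed
  qed auto
  also have "\<dots> = (\<Sum>P\<in>?Y. q - 1)"
  proof (rule sum.cong[OF refl])
    fix P assume "P \<in> ?Y"
    then have P: "vec.subspace P" "vec.dim P = 1" by (auto simp: points_of_def)
    then show "card (P - {0}) = q - 1"
      using vec.subspace_0[OF P(1)] by (simp add: card_eq_power)
  qed
  finally show ?thesis by (simp add: eq)
qed

lemma quadric_subset_points: "quadric Q \<subseteq> points_of UNIV"
  by (auto simp: quadric_def)

lemma span_singleton_in_quadric:
  assumes "v \<noteq> 0"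
  shows "vec.span {v} \<in> quadric Q \<longleftrightarrow> Q v = 0"
  using span_singleton_in_points_of[OF subspace_V assms]
  by (auto simp: quadric_def vec.span_singleton Q_scale intro: exI[of _ 1])

lemma m_ovoid_imp_ovoid_vectors:
  assumes X: "m_ovoid m Q X"
  shows "ovoid_vectors ((q - 1) * m) (vectors_of X)"
  unfolding ovoid_vectors_def
proof (intro conjI allI impI)
  have X': "X \<subseteq> quadric Q" using X by (simp add: m_ovoid_def)
  then show "vectors_of X \<subseteq> zeros UNIV - {0}"
    using span_singleton_in_quadric by (auto simp: vectors_of_def zeros_def)
  fix G assume G: "generator Q G"
  then have "vec.subspace G" by (simp add: generator_def totally_singular_def)
  then show "card (vectors_of X \<inter> G) = (q - 1) * m"
    using card_vectors_of[of X G] X' quadric_subset_points X G by (auto simp: m_ovoid_def)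
qed

lemma points_of_span_singleton:
  fixes v :: "'a ^ 'k"
  assumes v: "v \<noteq> 0"
  shows "points_of (vec.span {v}) = {vec.span {v}}"
proof
  show "{vec.span {v}} \<subseteq> points_of (vec.span {v})"
    using v vec.span_base[of v "{v}"] by (simp add: span_singleton_in_points_of)
  show "points_of (vec.span {v}) \<subseteq> {vec.span {v}}"
  proof
    fix P assume P: "P \<in> points_of (vec.span {v})"
    then have "P = vec.span {v}"
      using v dim_singleton[of v]
      by (intro card_subset_eq) (auto simp: points_of_def card_eq_power)
    then show "P \<in> {vec.span {v}}" by simp
  qed
qed

lemma card_m_ovoid_perp_pair:
  assumes X: "m_ovoid m Q X" and xy: "Q x = 0" "Q y = 0" "B x y \<noteq> 0"
  shows "int (card (X \<inter> points_of (perp {x, y}))) = int m * (int q ^ (n - 1) + 1)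
    - (of_bool (x \<in> vectors_of X) + of_bool (y \<in> vectors_of X)) * int q ^ (n - 1)"
proof -
  have X': "X \<subseteq> points_of UNIV"
    using X quadric_subset_points by (auto simp: m_ovoid_def)
  have q1: "int (q - 1) \<noteq> 0" using q_ge_2 by simp
  \<comment> \<open>A point contributes all its \<open>q - 1\<close> nonzero vectors or none, which
    turns the sizes in \<open>card_ovoid_perp_pair\<close> into truth values.\<close>
  have pt: "int (card (vectors_of X \<inter> vec.span {v})) = int (q - 1) * of_bool (v \<in> vectors_of X)"
    if "v \<noteq> 0" for v
    using that card_vectors_of[OF X', of "vec.span {v}"]
    by (auto simp: points_of_span_singleton vectors_of_def)
  have "x \<noteq> 0" "y \<noteq> 0" using xy by auto
  then have "int (q - 1) * int (card (X \<inter> points_of (perp {x, y})))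
      = int (q - 1) * (int m * (int q ^ (n - 1) + 1)
        - (of_bool (x \<in> vectors_of X) + of_bool (y \<in> vectors_of X)) * int q ^ (n - 1))"
    using card_ovoid_perp_pair[OF xy m_ovoid_imp_ovoid_vectors[OF X]]
      card_vectors_of[OF X' subspace_perp, of "{x, y}"] pt
    by (simp only: of_nat_mult) (simp add: algebra_simps)
  then show ?thesis using q1 by simp
qed

lemma elliptic_subquadric_iff:
  "E \<in> elliptic_subquadrics (n - 1) Q \<longleftrightarrow>
    (\<exists>x y. Q x = 0 \<and> Q y = 0 \<and> B x y \<noteq> 0 \<and> E = quadric Q \<inter> points_of (perp {x, y}))"
proof
  assume "E \<in> elliptic_subquadrics (n - 1) Q"
  then obtain W where W: "elliptic_on (n - 1) W Q" "E = quadric Q \<inter> points_of W"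
    by (auto simp: elliptic_subquadrics_def)
  from elliptic_on_imp_pair[OF W(1)] W(2)
  show "\<exists>x y. Q x = 0 \<and> Q y = 0 \<and> B x y \<noteq> 0 \<and> E = quadric Q \<inter> points_of (perp {x, y})"
    by metis
next
  assume "\<exists>x y. Q x = 0 \<and> Q y = 0 \<and> B x y \<noteq> 0 \<and> E = quadric Q \<inter> points_of (perp {x, y})"
  then show "E \<in> elliptic_subquadrics (n - 1) Q"
    using elliptic_perp_pair by (auto simp: elliptic_subquadrics_def)
qed

section \<open>The three intersection numbers\<close>

lemma card_subquadric_inter:
  assumes X: "m_ovoid m Q X" and xy: "Q x = 0" "Q y = 0" "B x y \<noteq> 0"
  shows "int (card (quadric Q \<inter> points_of (perp {x, y}) \<inter> X))
    = (int m - (of_bool (x \<in> vectors_of X) + of_bool (y \<in> vectors_of X))) * int q ^ (n - 1) + int m"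
proof -
  have "quadric Q \<inter> points_of (perp {x, y}) \<inter> X = X \<inter> points_of (perp {x, y})"
    using X by (auto simp: m_ovoid_def)
  then show ?thesis by (simp add: card_m_ovoid_perp_pair[OF assms] algebra_simps)
qed

lemma vectors_of_nonempty:
  assumes X: "m_ovoid m Q X" and m: "m \<ge> 1"
  shows "vectors_of X \<noteq> {}"
proof
  assume "vectors_of X = {}"
  then have "int ((q - 1) * m) * (int q ^ n * int q + 1) = 0"
    using card_ovoid[OF m_ovoid_imp_ovoid_vectors[OF X]] by simp
  moreover have "int q ^ n * int q + 1 > 0" by (simp add: add_nonneg_pos)
  ultimately show False using m q_ge_2 by simp
qed

lemma complement_vectors_nonempty:
  assumes "X \<subseteq> quadric Q" "X \<noteq> quadric Q"
  shows "zeros UNIV - {0} - vectors_of X \<noteq> {}"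
proof -
  obtain P where P: "P \<in> quadric Q" "P \<notin> X" using assms by blast
  then have "vec.subspace P" "vec.dim P = 1" by (auto simp: quadric_def points_of_def)
  then have "0 \<in> P" "P \<noteq> {0}" by (auto simp: vec.subspace_0)
  then obtain v where v: "v \<in> P" "v \<noteq> 0" by blast
  then have "vec.span {v} = P"
    using P quadric_subset_points by (intro points_of_eq_span[of P UNIV]) auto
  then have "v \<in> zeros UNIV - {0} - vectors_of X"
    using P v by (auto simp: zeros_def vectors_of_def quadric_def)
  then show ?thesis by blast
qed

text \<open>The three values correspond to two, one or no members of the ovoid in the pair. If
  \<open>X\<close> is the whole quadric, both members always belong to it and only the first value
  occurs, hence the condition on the other two. Integers are used because \<open>m - 2\<close> is
  negative for \<open>m = 1\<close>.\<close>

theorem elliptic_subquadrics_inter_m_ovoid: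
  assumes m: "m \<ge> 1" and X: "m_ovoid m Q X"
  shows "(\<forall>E \<in> elliptic_subquadrics (n - 1) Q.
            int (card (E \<inter> X)) = (int m - 2) * int q ^ (n - 1) + int m \<or>
            int (card (E \<inter> X)) = (int m - 1) * int q ^ (n - 1) + int m \<or>
            int (card (E \<inter> X)) = int m * int q ^ (n - 1) + int m) \<and>
         (\<exists>E \<in> elliptic_subquadrics (n - 1) Q.
            int (card (E \<inter> X)) = (int m - 2) * int q ^ (n - 1) + int m) \<and>
         (X \<noteq> quadric Q \<longrightarrow>
            (\<exists>E \<in> elliptic_subquadrics (n - 1) Q.
               int (card (E \<inter> X)) = (int m - 1) * int q ^ (n - 1) + int m) \<and>
            (\<exists>E \<in> elliptic_subquadrics (n - 1) Q.
               int (card (E \<inter> X)) = int m * int q ^ (n - 1) + int m))"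
    (is "?range \<and> ?two \<and> (_ \<longrightarrow> ?one \<and> ?zero)")
proof (intro conjI impI)
  note card = card_subquadric_inter[OF X]
  let ?S = "vectors_of X" and ?T = "zeros UNIV - {0} - vectors_of X"
  note S = m_ovoid_imp_ovoid_vectors[OF X]
  have Sz: "Q x = 0 \<and> x \<noteq> 0" if "x \<in> ?S" for x
    using S that by (auto simp: ovoid_vectors_def zeros_def)
  have in_sub: "quadric Q \<inter> points_of (perp {x, y}) \<in> elliptic_subquadrics (n - 1) Q"
    if "Q x = 0" "Q y = 0" "B x y \<noteq> 0" for x y
    using that elliptic_subquadric_iff by blast
  show ?range
  proof
    fix E assume "E \<in> elliptic_subquadrics (n - 1) Q"
    then obtain x y where xy: "Q x = 0" "Q y = 0" "B x y \<noteq> 0"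
      and E: "E = quadric Q \<inter> points_of (perp {x, y})"
      using elliptic_subquadric_iff by blast
    show "int (card (E \<inter> X)) = (int m - 2) * int q ^ (n - 1) + int m \<or>
        int (card (E \<inter> X)) = (int m - 1) * int q ^ (n - 1) + int m \<or>
        int (card (E \<inter> X)) = int m * int q ^ (n - 1) + int m"
      unfolding E card[OF xy] by (cases "x \<in> ?S"; cases "y \<in> ?S") simp_all
  qed
  have ne: "?S \<noteq> {}" by (rule vectors_of_nonempty[OF X m])
  then obtain x where x: "x \<in> ?S" by blast
  obtain y where y: "y \<in> ?S" "B x y \<noteq> 0"
    using ex_ovoid_not_perp[OF S ne, of x] Sz[OF x] by blast
  show ?two
    using in_sub[of x y] card[of x y] Sz[OF x] Sz[OF y(1)] x y by (intro bexI) auto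
  assume "X \<noteq> quadric Q"
  then have Tne: "?T \<noteq> {}"
    using X by (intro complement_vectors_nonempty) (auto simp: m_ovoid_def)
  \<comment> \<open>One singular point \<open>z\<close> outside the ovoid serves both remaining
    cases, with a partner \<open>s\<close> in the ovoid or \<open>t\<close> in its
    complement.\<close>
  then obtain z where z: "z \<in> ?T" by blast
  have z0: "Q z = 0" "z \<noteq> 0" "z \<notin> ?S" using z by (auto simp: zeros_def)
  obtain s where s: "s \<in> ?S" "B z s \<noteq> 0"
    using ex_ovoid_not_perp[OF S ne z0(1,2)] .
  show ?one
    using in_sub[of z s] card[of z s] Sz[OF s(1)] z0 s by (intro bexI) auto
  obtain t where t: "t \<in> ?T" "B z t \<noteq> 0"
    using ex_ovoid_not_perp[OF ovoid_vectors_complement[OF S] Tne z0(1,2)] .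
  have "Q t = 0" "t \<notin> ?S" using t by (auto simp: zeros_def)
  then show ?zero
    using in_sub[of z t] card[of z t] z0 t by (intro bexI) auto
qed

end

theorem proposition3p2:
  fixes Q :: "('a::{field,finite}) ^ 'k \<Rightarrow> 'a"
    and \<O> :: "('a ^ 'k) set set"
    and q n m :: nat
  assumes "q = CARD('a)"
    and "n \<ge> 2" and "m \<ge> 1"
    and "CARD('k) = 2 * n + 2"
    and "quadratic_form Q"
    and "elliptic_on n UNIV Q"
    and "m_ovoid m Q \<O>"
  shows "(\<forall>E \<in> elliptic_subquadrics (n - 1) Q.
            int (card (E \<inter> \<O>)) = (int m - 2) * int q ^ (n - 1) + int m \<or>
            int (card (E \<inter> \<O>)) = (int m - 1) * int q ^ (n - 1) + int m \<or>
            int (card (E \<inter> \<O>)) = int m * int q ^ (n - 1) + int m) \<and>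
         (\<exists>E \<in> elliptic_subquadrics (n - 1) Q.
            int (card (E \<inter> \<O>)) = (int m - 2) * int q ^ (n - 1) + int m) \<and>
         (\<O> \<noteq> quadric Q \<longrightarrow>
            (\<exists>E \<in> elliptic_subquadrics (n - 1) Q.
               int (card (E \<inter> \<O>)) = (int m - 1) * int q ^ (n - 1) + int m) \<and>
            (\<exists>E \<in> elliptic_subquadrics (n - 1) Q.
               int (card (E \<inter> \<O>)) = int m * int q ^ (n - 1) + int m))"
proof -
  interpret elliptic_space Q q n
    using assms by unfold_locales
  show ?thesis
    by (rule elliptic_subquadrics_inter_m_ovoid) (use assms in auto)
qed

end
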